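(* Let $M$ be a globally hyperbolic Lorentzian manifold, let $P$ be a normally hyperbolic operator acting on sections of a complex vector bundle $E$ over $M$, and let $U\subseteq M$ be a GE set. For $z\in\mathbb{C}$ and $k\in\mathbb{N}$, let $V^k$ denote the Hadamard coefficients of $P$ on $U$ and $V^k(z)$ the Hadamard coefficients of $P-z$ on $U$. Then \[V^{k}(z)=\sum_{m=0}^k\binom{k}{m}z^mV^{k-m}.\]
   Context: Conventions. $\mathbb{N}=\{0,1,2,\dots\}$. $M$ is a globally hyperbolic (in particular time-oriented) Lorentzian manifold of dimension $d$ with metric $g$ of signature $(-,+,\dots,+)$; $J_+(x)$ and $J_-(x)$ denote the causal future and causal past. Normally hyperbolic operator: a second order linear differential operator $P$ on sections of $E$ whose principal symbol is minus the metric, i.e. locally $P=-g^{ij}\partial_i\partial_j+$ lower order terms; $P-z$ is then also normally hyperbolic. On functions, $\square f=-\operatorname{div}\operatorname{grad} f$. The connection $\nabla$ induced by $P$ is the unique connection on $E$ with $P(fs)=fPs-2\nabla_{\operatorname{grad}f}s+(\square f)s$ for smooth functions $f$ and smooth sections $s$. GE set: a subset $U\subseteq M$ that is open, geodesically convex (for each $x\in U$, $\exp_x$ maps an open star-shaped neighbourhood of $0$ in $T_xM$ diffeomorphically onto $U$; $\exp_x^{-1}$ denotes the inverse of this map), globally hyperbolic, and causally compatible ($J^U_\pm(x)=J^M_\pm(x)\cap U$ for all $x\in U$). Hadamard coefficients: for $x,y\in U$ let $\Gamma(y,x)=-g(\exp_x^{-1}(y),\exp_x^{-1}(y))$. For smooth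 sections $V$ of $E\boxtimes E^*|_{U\times U}$ put $(\rho V)(y,x)=\nabla_{\operatorname{grad}\Gamma(y,x)}V(y,x)-\big(\tfrac12\square\Gamma(y,x)-d\big)V(y,x)$, where $\nabla$ is the connection induced by the operator and $\nabla,\operatorname{grad},\square$ (and $P$ below) act in the first variable $y$. The Hadamard coefficients $V^{k}=V^{k,U}$ ($k\in\mathbb{N}$) of a normally hyperbolic operator $P$ on $U$ are the unique family of smooth sections of $E\boxtimes E^*|_{U\times U}$ with $(\rho-2k)V^{k}=2k\,PV^{k-1}$ for all $k\in\mathbb{N}$ (right hand side set to $0$ for $k=0$) and $V^{0}(x,x)=\mathrm{id}_{E_x}$ for all $x\in U$. *)

theory Defs
  imports "HOL-Analysis.Analysis"
begin

section \<open>Smooth functions on open sets of normed spaces\<close>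

text \<open>Only used for open \<open>S\<close>.\<close>

primrec Ck_on :: "nat \<Rightarrow> 'a::real_normed_vector set \<Rightarrow> ('a \<Rightarrow> 'b::real_normed_vector) \<Rightarrow> bool" where
  "Ck_on 0 S f \<longleftrightarrow> continuous_on S f"
| "Ck_on (Suc n) S f \<longleftrightarrow> (\<forall>x\<in>S. f differentiable (at x)) \<and>
     (\<forall>v. Ck_on n S (\<lambda>x. frechet_derivative f (at x) v))"

definition smooth_on :: "'a::real_normed_vector set \<Rightarrow> ('a \<Rightarrow> 'b::real_normed_vector) \<Rightarrow> bool" where
  "smooth_on S f \<longleftrightarrow> (\<forall>n. Ck_on n S f)"


section \<open>Smooth manifolds\<close>

text \<open>The manifold is a whole type \<open>'m\<close> (Hausdorff, second countable) with an atlas of charts with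
  values in \<open>real^'d\<close>; its dimension is \<open>CARD('d)\<close>. A chart is a pair of its domain and its
  coordinate map.\<close>

type_synonym ('m, 'd) chart = "'m set \<times> ('m \<Rightarrow> real^'d)"

text \<open>A tangent vector at \<open>p\<close> is the family of its components in the charts around \<open>p\<close>,
  related by the derivatives of the coordinate changes. It is \<open>0\<close> at all other arguments, so that
  equality of tangent vectors is equality of functions.\<close>

type_synonym ('m, 'd) tangent = "('m, 'd) chart \<Rightarrow> real^'d"

record ('m, 'd::finite) spacetime =
  atlas :: "('m, 'd) chart set"
  metric :: "'m \<Rightarrow> ('m, 'd) tangent \<Rightarrow> ('m, 'd) tangent \<Rightarrow> real"
  torient :: "'m \<Rightarrow> ('m, 'd) tangent"

definition chart_inv :: "('m, 'd::finite) chart \<Rightarrow> real^'d \<Rightarrow> 'm" where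
  "chart_inv c = inv_into (fst c) (snd c)"

definition transition :: "('m, 'd::finite) chart \<Rightarrow> ('m, 'd) chart \<Rightarrow> real^'d \<Rightarrow> real^'d" where
  "transition c c' = snd c' \<circ> chart_inv c"

definition smooth_atlas :: "('m::topological_space, 'd::finite) chart set \<Rightarrow> bool" where
  "smooth_atlas A \<longleftrightarrow>
     (\<forall>c\<in>A. open (fst c) \<and> open (snd c ` fst c) \<and>
        (\<exists>\<psi>. homeomorphism (fst c) (snd c ` fst c) (snd c) \<psi>)) \<and>
     (\<Union>c\<in>A. fst c) = UNIV \<and>
     (\<forall>c\<in>A. \<forall>c'\<in>A. smooth_on (snd c ` (fst c \<inter> fst c')) (transition c c'))"

definition smooth_fun ::
  "('m, 'd::finite) spacetime \<Rightarrow> 'm set \<Rightarrow> ('m \<Rightarrow> 'b::real_normed_vector) \<Rightarrow> bool" where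
  "smooth_fun M W f \<longleftrightarrow>
     (\<forall>c\<in>atlas M. smooth_on (snd c ` (fst c \<inter> W)) (f \<circ> chart_inv c))"

definition tangent_space :: "('m, 'd::finite) spacetime \<Rightarrow> 'm \<Rightarrow> ('m, 'd) tangent set" where
  "tangent_space M p = {v. \<forall>c.
     (c \<in> atlas M \<and> p \<in> fst c \<longrightarrow> (\<forall>c'\<in>atlas M. p \<in> fst c' \<longrightarrow>
        v c' = frechet_derivative (transition c c') (at (snd c p)) (v c))) \<and>
     (\<not> (c \<in> atlas M \<and> p \<in> fst c) \<longrightarrow> v c = 0)}"

text \<open>The tangent vector at \<open>p\<close> with components \<open>w\<close> in the chart \<open>c\<close>.\<close>

definition tvec :: "('m, 'd::finite) spacetime \<Rightarrow> ('m, 'd) chart \<Rightarrow> 'm \<Rightarrow> real^'d \<Rightarrow> ('m, 'd) tangent" where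
  "tvec M c p w = (\<lambda>c'. if c' \<in> atlas M \<and> p \<in> fst c'
     then frechet_derivative (transition c c') (at (snd c p)) w else 0)"

definition smooth_vector_field ::
  "('m, 'd::finite) spacetime \<Rightarrow> 'm set \<Rightarrow> ('m \<Rightarrow> ('m, 'd) tangent) \<Rightarrow> bool" where
  "smooth_vector_field M W X \<longleftrightarrow> (\<forall>p\<in>W. X p \<in> tangent_space M p) \<and>
     (\<forall>c\<in>atlas M. smooth_on (snd c ` (fst c \<inter> W)) (\<lambda>u. X (chart_inv c u) c))"

definition chart_at :: "('m, 'd::finite) spacetime \<Rightarrow> 'm \<Rightarrow> ('m, 'd) chart" where
  "chart_at M p = (SOME c. c \<in> atlas M \<and> p \<in> fst c)"

text \<open>The partial derivative \<open>\<partial>\<^sub>i f\<close> at \<open>p\<close> in the chart \<open>c\<close>.\<close>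

definition pd :: "('m, 'd::finite) chart \<Rightarrow> 'd \<Rightarrow> ('m \<Rightarrow> 'b::real_normed_vector) \<Rightarrow> 'm \<Rightarrow> 'b" where
  "pd c i f p = frechet_derivative (f \<circ> chart_inv c) (at (snd c p)) (axis i 1)"

text \<open>The differential \<open>df\<^sub>p(v)\<close>; it does not depend on the chosen chart.\<close>

definition differential ::
  "('m, 'd::finite) spacetime \<Rightarrow> ('m \<Rightarrow> 'b::real_normed_vector) \<Rightarrow> 'm \<Rightarrow> ('m, 'd) tangent \<Rightarrow> 'b" where
  "differential M f p v = (let c = chart_at M p in
     frechet_derivative (f \<circ> chart_inv c) (at (snd c p)) (v c))"


section \<open>Time-oriented Lorentzian manifolds\<close>

definition gmat :: "('m, 'd::finite) spacetime \<Rightarrow> ('m, 'd) chart \<Rightarrow> 'm \<Rightarrow> real^'d^'d" where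
  "gmat M c p = (\<chi> i j. metric M p (tvec M c p (axis i 1)) (tvec M c p (axis j 1)))"

definition ginv :: "('m, 'd::finite) spacetime \<Rightarrow> ('m, 'd) chart \<Rightarrow> 'm \<Rightarrow> real^'d^'d" where
  "ginv M c p = matrix_inv (gmat M c p)"

definition lorentzian_metric :: "('m, 'd::finite) spacetime \<Rightarrow> bool" where
  "lorentzian_metric M \<longleftrightarrow>
     (\<forall>p. \<forall>u\<in>tangent_space M p. \<forall>v\<in>tangent_space M p. \<forall>w\<in>tangent_space M p. \<forall>a.
        metric M p u v = metric M p v u \<and>
        metric M p (\<lambda>c. a *\<^sub>R u c + v c) w = a * metric M p u w + metric M p v w) \<and>
     (\<forall>p. \<exists>i\<^sub>0. \<exists>b :: 'd \<Rightarrow> ('m, 'd) tangent. \<forall>i j. b i \<in> tangent_space M p \<and>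
        metric M p (b i) (b j) = (if i \<noteq> j then 0 else if i = i\<^sub>0 then - 1 else 1)) \<and>
     (\<forall>c\<in>atlas M. \<forall>i j. smooth_on (snd c ` fst c) (\<lambda>u. gmat M c (chart_inv c u) $ i $ j))"

text \<open>The time orientation is represented by a continuous timelike vector field.\<close>

definition time_orientation :: "('m::topological_space, 'd::finite) spacetime \<Rightarrow> bool" where
  "time_orientation M \<longleftrightarrow>
     (\<forall>p. torient M p \<in> tangent_space M p \<and> metric M p (torient M p) (torient M p) < 0) \<and>
     (\<forall>c\<in>atlas M. continuous_on (fst c) (\<lambda>p. torient M p c))"

definition lorentzian_manifold :: "('m::topological_space, 'd::finite) spacetime \<Rightarrow> bool" where
  "lorentzian_manifold M \<longleftrightarrow> smooth_atlas (atlas M) \<and> lorentzian_metric M \<and> time_orientation M"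

definition gradient ::
  "('m, 'd::finite) spacetime \<Rightarrow> ('m \<Rightarrow> real) \<Rightarrow> 'm \<Rightarrow> ('m, 'd) tangent" where
  "gradient M f p = (THE v. v \<in> tangent_space M p \<and>
     (\<forall>w\<in>tangent_space M p. metric M p v w = differential M f p w))"

text \<open>\<open>div X = |det g|\<^sup>-\<^sup>1\<^sup>/\<^sup>2 \<Sum>\<^sub>i \<partial>\<^sub>i (|det g|\<^sup>1\<^sup>/\<^sup>2 X\<^sup>i)\<close> in any chart.\<close>

definition divergence ::
  "('m, 'd::finite) spacetime \<Rightarrow> ('m \<Rightarrow> ('m, 'd) tangent) \<Rightarrow> 'm \<Rightarrow> real" where
  "divergence M X p = (let c = chart_at M p in
     (\<Sum>i\<in>UNIV. pd c i (\<lambda>q. sqrt \<bar>det (gmat M c q)\<bar> * X q c $ i) p) / sqrt \<bar>det (gmat M c p)\<bar>)"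

definition box :: "('m, 'd::finite) spacetime \<Rightarrow> ('m \<Rightarrow> real) \<Rightarrow> 'm \<Rightarrow> real" where
  "box M f p = - divergence M (gradient M f) p"


section \<open>Causality\<close>

text \<open>\<open>\<gamma>\<close> is continuously differentiable on \<open>I\<close> with velocity \<open>u\<close>.\<close>

definition C1_curve ::
  "('m::topological_space, 'd::finite) spacetime \<Rightarrow> real set \<Rightarrow> (real \<Rightarrow> 'm) \<Rightarrow>
     (real \<Rightarrow> ('m, 'd) tangent) \<Rightarrow> bool" where
  "C1_curve M I \<gamma> u \<longleftrightarrow> continuous_on I \<gamma> \<and>
     (\<forall>t\<in>I. u t \<in> tangent_space M (\<gamma> t)) \<and>
     (\<forall>c\<in>atlas M.
        (\<forall>t\<in>I. \<gamma> t \<in> fst c \<longrightarrow> ((snd c \<circ> \<gamma>) has_vector_derivative u t c) (at t within I)) \<and>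
        continuous_on {t\<in>I. \<gamma> t \<in> fst c} (\<lambda>t. u t c))"

definition future_causal :: "('m, 'd::finite) spacetime \<Rightarrow> 'm \<Rightarrow> ('m, 'd) tangent \<Rightarrow> bool" where
  "future_causal M p v \<longleftrightarrow> v \<in> tangent_space M p \<and> v \<noteq> (\<lambda>_. 0) \<and>
     metric M p v v \<le> 0 \<and> metric M p v (torient M p) < 0"

definition causal_step ::
  "('m::topological_space, 'd::finite) spacetime \<Rightarrow> 'm set \<Rightarrow> 'm \<Rightarrow> 'm \<Rightarrow> bool" where
  "causal_step M W p q \<longleftrightarrow> (\<exists>\<gamma> u. C1_curve M {0..1} \<gamma> u \<and> \<gamma> ` {0..1} \<subseteq> W \<and>
     \<gamma> 0 = p \<and> \<gamma> 1 = q \<and> (\<forall>t\<in>{0..1}. future_causal M (\<gamma> t) (u t)))"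

text \<open>Causal future and past of a point of the open set \<open>W\<close>, regarded as a spacetime of its own
  (\<open>W = UNIV\<close> for the whole manifold). The closure under composition accounts for causal curves
  being piecewise continuously differentiable.\<close>

definition J_plus :: "('m::topological_space, 'd::finite) spacetime \<Rightarrow> 'm set \<Rightarrow> 'm \<Rightarrow> 'm set" where
  "J_plus M W x = {y. (causal_step M W)\<^sup>*\<^sup>* x y}"

definition J_minus :: "('m::topological_space, 'd::finite) spacetime \<Rightarrow> 'm set \<Rightarrow> 'm \<Rightarrow> 'm set" where
  "J_minus M W x = {y. (causal_step M W)\<^sup>*\<^sup>* y x}"

text \<open>Strong causality (the points of \<open>J_plus M W a \<inter> J_minus M W b\<close> are those on causal curves
  from \<open>a\<close> to \<open>b\<close>) and compactness of the causal diamonds.\<close>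

definition globally_hyperbolic ::
  "('m::topological_space, 'd::finite) spacetime \<Rightarrow> 'm set \<Rightarrow> bool" where
  "globally_hyperbolic M W \<longleftrightarrow>
     (\<forall>p\<in>W. \<forall>N. open N \<and> p \<in> N \<and> N \<subseteq> W \<longrightarrow>
        (\<exists>N'. open N' \<and> p \<in> N' \<and> N' \<subseteq> N \<and>
           (\<forall>a\<in>N'. \<forall>b\<in>N'. J_plus M W a \<inter> J_minus M W b \<subseteq> N))) \<and>
     (\<forall>x\<in>W. \<forall>y\<in>W. compact (J_plus M W x \<inter> J_minus M W y))"

definition causally_compatible ::
  "('m::topological_space, 'd::finite) spacetime \<Rightarrow> 'm set \<Rightarrow> bool" where
  "causally_compatible M U \<longleftrightarrow> (\<forall>x\<in>U.
     J_plus M U x = J_plus M UNIV x \<inter> U \<and> J_minus M U x = J_minus M UNIV x \<inter> U)"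


section \<open>Geodesics and the exponential map\<close>

text \<open>The Christoffel symbol \<open>\<Gamma>\<^sup>k\<^sub>i\<^sub>j\<close> of the Levi-Civita connection in the chart \<open>c\<close>.\<close>

definition christoffel ::
  "('m, 'd::finite) spacetime \<Rightarrow> ('m, 'd) chart \<Rightarrow> 'm \<Rightarrow> 'd \<Rightarrow> 'd \<Rightarrow> 'd \<Rightarrow> real" where
  "christoffel M c p k i j = (1/2) * (\<Sum>l\<in>UNIV. ginv M c p $ k $ l *
     (pd c i (\<lambda>q. gmat M c q $ j $ l) p + pd c j (\<lambda>q. gmat M c q $ i $ l) p
      - pd c l (\<lambda>q. gmat M c q $ i $ j) p))"

definition geodesic ::
  "('m::topological_space, 'd::finite) spacetime \<Rightarrow> real set \<Rightarrow> (real \<Rightarrow> 'm) \<Rightarrow>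
     (real \<Rightarrow> ('m, 'd) tangent) \<Rightarrow> bool" where
  "geodesic M I \<gamma> u \<longleftrightarrow> C1_curve M I \<gamma> u \<and>
     (\<forall>c\<in>atlas M. \<forall>t\<in>I. \<gamma> t \<in> fst c \<longrightarrow>
        ((\<lambda>s. u s c) has_vector_derivative
          (\<chi> k. - (\<Sum>i\<in>UNIV. \<Sum>j\<in>UNIV. christoffel M c (\<gamma> t) k i j * u t c $ i * u t c $ j)))
          (at t within I))"

definition exp_rel ::
  "('m::topological_space, 'd::finite) spacetime \<Rightarrow> 'm \<Rightarrow> ('m, 'd) tangent \<Rightarrow> 'm \<Rightarrow> bool" where
  "exp_rel M x v y \<longleftrightarrow> (\<exists>\<gamma> u. geodesic M {0..1} \<gamma> u \<and> \<gamma> 0 = x \<and> u 0 = v \<and> \<gamma> 1 = y)"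

definition exp_dom :: "('m::topological_space, 'd::finite) spacetime \<Rightarrow> 'm \<Rightarrow> ('m, 'd) tangent set" where
  "exp_dom M x = {v \<in> tangent_space M x. \<exists>y. exp_rel M x v y}"

definition exp_map ::
  "('m::topological_space, 'd::finite) spacetime \<Rightarrow> 'm \<Rightarrow> ('m, 'd) tangent \<Rightarrow> 'm" where
  "exp_map M x v = (THE y. exp_rel M x v y)"

text \<open>\<open>\<Omega>\<close> is an open star-shaped neighbourhood of \<open>0\<close> in the tangent space at \<open>x\<close> that
  \<open>exp_map M x\<close> maps diffeomorphically onto \<open>U\<close>. Openness and smoothness in the tangent space are
  expressed through its linear identification \<open>tvec M c x\<close> with \<open>real^'d\<close>.\<close>

definition normal_domain ::
  "('m::topological_space, 'd::finite) spacetime \<Rightarrow> 'm set \<Rightarrow> 'm \<Rightarrow> ('m, 'd) tangent set \<Rightarrow> bool" where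
  "normal_domain M U x \<Omega> \<longleftrightarrow>
     \<Omega> \<subseteq> exp_dom M x \<and> (\<lambda>_. 0) \<in> \<Omega> \<and>
     (\<forall>v\<in>\<Omega>. \<forall>t\<in>{0..1}. (\<lambda>c. t *\<^sub>R v c) \<in> \<Omega>) \<and>
     bij_betw (exp_map M x) \<Omega> U \<and>
     (\<forall>c\<in>atlas M. x \<in> fst c \<longrightarrow>
        (let B = {w. tvec M c x w \<in> \<Omega>}; F = (\<lambda>w. exp_map M x (tvec M c x w)) in
          open B \<and> continuous_on B F \<and>
          (\<forall>c'\<in>atlas M. smooth_on {w\<in>B. F w \<in> fst c'} (snd c' \<circ> F)) \<and>
          smooth_fun M U (\<lambda>y. inv_into \<Omega> (exp_map M x) y c)))"

definition GE_set :: "('m::topological_space, 'd::finite) spacetime \<Rightarrow> 'm set \<Rightarrow> bool" where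
  "GE_set M U \<longleftrightarrow> open U \<and> (\<forall>x\<in>U. \<exists>\<Omega>. normal_domain M U x \<Omega>) \<and>
     globally_hyperbolic M U \<and> causally_compatible M U"

text \<open>The set \<open>\<Omega>\<close> above is uniquely determined by \<open>U\<close> and \<open>x\<close>, because geodesic rays lift
  uniquely.\<close>

definition exp_inv ::
  "('m::topological_space, 'd::finite) spacetime \<Rightarrow> 'm set \<Rightarrow> 'm \<Rightarrow> 'm \<Rightarrow> ('m, 'd) tangent" where
  "exp_inv M U x y = inv_into (THE \<Omega>. normal_domain M U x \<Omega>) (exp_map M x) y"

definition Gam :: "('m::topological_space, 'd::finite) spacetime \<Rightarrow> 'm set \<Rightarrow> 'm \<Rightarrow> 'm \<Rightarrow> real" where
  "Gam M U y x = - metric M x (exp_inv M U x y) (exp_inv M U x y)"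


section \<open>Complex vector bundles\<close>

text \<open>The fibres are complex subspaces of one ambient complex vector space \<open>'e\<close> with scalar
  multiplication \<open>scl\<close>. This is no restriction, as \<open>'e\<close> may be the direct sum of all fibres, and
  the ambient space carries no topology. A trivialization is an open set with
  linear isomorphisms from the fibres over it onto the space of \<open>rk\<close>-tuples of complex numbers.
  Operators act on locally defined sections, hence on total functions \<open>'m \<Rightarrow> 'e\<close>.\<close>

record ('m, 'e) cbundle =
  scl :: "complex \<Rightarrow> 'e \<Rightarrow> 'e"
  fibre :: "'m \<Rightarrow> 'e set"
  rk :: nat
  trivs :: "('m set \<times> ('m \<Rightarrow> 'e \<Rightarrow> nat \<Rightarrow> complex)) set"

definition complex_vector_bundle ::
  "('m::topological_space, 'd::finite) spacetime \<Rightarrow> ('m, 'e::ab_group_add) cbundle \<Rightarrow> bool" where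
  "complex_vector_bundle M E \<longleftrightarrow>
     vector_space (scl E) \<and> (\<forall>p. module.subspace (scl E) (fibre E p)) \<and>
     (\<Union>(B, \<Phi>)\<in>trivs E. B) = UNIV \<and>
     (\<forall>(B, \<Phi>)\<in>trivs E. open B \<and> (\<forall>p\<in>B.
        (\<forall>a. \<forall>e\<in>fibre E p. \<forall>e'\<in>fibre E p. \<forall>i<rk E.
           \<Phi> p (scl E a e + e') i = a * \<Phi> p e i + \<Phi> p e' i) \<and>
        bij_betw (\<lambda>e. restrict (\<Phi> p e) {..<rk E}) (fibre E p) ({..<rk E} \<rightarrow>\<^sub>E UNIV))) \<and>
     (\<forall>(B, \<Phi>)\<in>trivs E. \<forall>(B', \<Phi>')\<in>trivs E. \<exists>T :: nat \<Rightarrow> nat \<Rightarrow> 'm \<Rightarrow> complex.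
        (\<forall>i<rk E. \<forall>j<rk E. smooth_fun M (B \<inter> B') (T i j)) \<and>
        (\<forall>p\<in>B \<inter> B'. \<forall>e\<in>fibre E p. \<forall>i<rk E.
           \<Phi>' p e i = (\<Sum>j<rk E. T i j p * \<Phi> p e j)))"

definition smooth_section ::
  "('m, 'd::finite) spacetime \<Rightarrow> ('m, 'e) cbundle \<Rightarrow> 'm set \<Rightarrow> ('m \<Rightarrow> 'e) \<Rightarrow> bool" where
  "smooth_section M E W s \<longleftrightarrow> (\<forall>p\<in>W. s p \<in> fibre E p) \<and>
     (\<forall>(B, \<Phi>)\<in>trivs E. \<forall>i<rk E. smooth_fun M (W \<inter> B) (\<lambda>p. \<Phi> p (s p) i))"

text \<open>The \<open>j\<close>-th vector of the frame of the trivialization \<open>\<Phi>\<close> at \<open>p\<close>.\<close>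

definition frame ::
  "('m, 'e) cbundle \<Rightarrow> ('m \<Rightarrow> 'e \<Rightarrow> nat \<Rightarrow> complex) \<Rightarrow> nat \<Rightarrow> 'm \<Rightarrow> 'e" where
  "frame E \<Phi> j p = (THE e. e \<in> fibre E p \<and> (\<forall>i<rk E. \<Phi> p e i = (if i = j then 1 else 0)))"

text \<open>Smooth sections of \<open>E \<boxtimes> E\<^sup>*\<close> over \<open>U \<times> U\<close>: the value \<open>V y x\<close> is a linear map from the fibre
  over \<open>x\<close> to the fibre over \<open>y\<close>, with matrix entries depending smoothly on \<open>(y, x)\<close>.\<close>

definition smooth_kernel ::
  "('m, 'd::finite) spacetime \<Rightarrow> ('m, 'e::ab_group_add) cbundle \<Rightarrow> 'm set \<Rightarrow>
     ('m \<Rightarrow> 'm \<Rightarrow> 'e \<Rightarrow> 'e) \<Rightarrow> bool" where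
  "smooth_kernel M E U V \<longleftrightarrow>
     (\<forall>y\<in>U. \<forall>x\<in>U. \<forall>e\<in>fibre E x. \<forall>e'\<in>fibre E x. \<forall>a.
        V y x e \<in> fibre E y \<and> V y x (scl E a e + e') = scl E a (V y x e) + V y x e') \<and>
     (\<forall>c\<in>atlas M. \<forall>c'\<in>atlas M. \<forall>(B, \<Phi>)\<in>trivs E. \<forall>(B', \<Phi>')\<in>trivs E.
        \<forall>i<rk E. \<forall>j<rk E.
        smooth_on ((snd c ` (fst c \<inter> B \<inter> U)) \<times> (snd c' ` (fst c' \<inter> B' \<inter> U)))
          (\<lambda>(a, b). let y = chart_inv c a; x = chart_inv c' b in
             \<Phi> y (V y x (frame E \<Phi>' j x)) i))"


section \<open>Normally hyperbolic operators and their connections\<close>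

text \<open>In local coordinates and a local trivialization, \<open>P\<close> is
  \<open>- g\<^sup>k\<^sup>l \<partial>\<^sub>k \<partial>\<^sub>l\<close> plus terms of order at most one with smooth matrix-valued coefficients.\<close>

definition normally_hyperbolic ::
  "('m::topological_space, 'd::finite) spacetime \<Rightarrow> ('m, 'e) cbundle \<Rightarrow>
     (('m \<Rightarrow> 'e) \<Rightarrow> ('m \<Rightarrow> 'e)) \<Rightarrow> bool" where
  "normally_hyperbolic M E P \<longleftrightarrow>
     (\<forall>c\<in>atlas M. \<forall>(B, \<Phi>)\<in>trivs E.
        \<exists>(a :: 'd \<Rightarrow> nat \<Rightarrow> nat \<Rightarrow> 'm \<Rightarrow> complex) (b :: nat \<Rightarrow> nat \<Rightarrow> 'm \<Rightarrow> complex).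
        (\<forall>i<rk E. \<forall>j<rk E. smooth_fun M (fst c \<inter> B) (b i j) \<and>
           (\<forall>k. smooth_fun M (fst c \<inter> B) (a k i j))) \<and>
        (\<forall>W s. open W \<and> smooth_section M E W s \<longrightarrow> (\<forall>p\<in>W \<inter> fst c \<inter> B.
           P s p \<in> fibre E p \<and>
           (\<forall>i<rk E. \<Phi> p (P s p) i =
              - (\<Sum>k\<in>UNIV. \<Sum>l\<in>UNIV. of_real (ginv M c p $ k $ l) *
                   pd c k (pd c l (\<lambda>q. \<Phi> q (s q) i)) p)
              + (\<Sum>k\<in>UNIV. \<Sum>j<rk E. a k i j p * pd c k (\<lambda>q. \<Phi> q (s q) j) p)
              + (\<Sum>j<rk E. b i j p * \<Phi> p (s p) j)))))"

text \<open>\<open>D s p v\<close> is the covariant derivative of the local section \<open>s\<close> in direction \<open>v\<close> at \<open>p\<close>.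
  The second clause of the definition is locality; the Leibniz rule for complex-valued functions
  includes complex linearity.\<close>

definition is_connection ::
  "('m::topological_space, 'd::finite) spacetime \<Rightarrow> ('m, 'e::ab_group_add) cbundle \<Rightarrow>
     (('m \<Rightarrow> 'e) \<Rightarrow> 'm \<Rightarrow> ('m, 'd) tangent \<Rightarrow> 'e) \<Rightarrow> bool" where
  "is_connection M E D \<longleftrightarrow>
     (\<forall>W s. open W \<and> smooth_section M E W s \<longrightarrow>
        (\<forall>p\<in>W. \<forall>v\<in>tangent_space M p. \<forall>w\<in>tangent_space M p. \<forall>r :: real.
           D s p v \<in> fibre E p \<and>
           D s p (\<lambda>c. r *\<^sub>R v c + w c) = scl E (of_real r) (D s p v) + D s p w) \<and>
        (\<forall>s'. (\<forall>q\<in>W. s' q = s q) \<longrightarrow> (\<forall>p\<in>W. \<forall>v\<in>tangent_space M p. D s' p v = D s p v)) \<and>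
        (\<forall>s'. smooth_section M E W s' \<longrightarrow> (\<forall>p\<in>W. \<forall>v\<in>tangent_space M p.
           D (\<lambda>q. s q + s' q) p v = D s p v + D s' p v)) \<and>
        (\<forall>f :: 'm \<Rightarrow> complex. smooth_fun M W f \<longrightarrow> (\<forall>p\<in>W. \<forall>v\<in>tangent_space M p.
           D (\<lambda>q. scl E (f q) (s q)) p v =
             scl E (f p) (D s p v) + scl E (differential M f p v) (s p))) \<and>
        (\<forall>X. smooth_vector_field M W X \<longrightarrow> smooth_section M E W (\<lambda>p. D s p (X p))))"

text \<open>This determines \<open>D\<close> on smooth local sections and tangent vectors, which is all that is used
  of it.\<close>

definition induced_connection ::
  "('m::topological_space, 'd::finite) spacetime \<Rightarrow> ('m, 'e::ab_group_add) cbundle \<Rightarrow>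
     (('m \<Rightarrow> 'e) \<Rightarrow> ('m \<Rightarrow> 'e)) \<Rightarrow> (('m \<Rightarrow> 'e) \<Rightarrow> 'm \<Rightarrow> ('m, 'd) tangent \<Rightarrow> 'e) \<Rightarrow> bool" where
  "induced_connection M E P D \<longleftrightarrow> is_connection M E D \<and>
     (\<forall>W s f. open W \<and> smooth_section M E W s \<and> smooth_fun M W f \<longrightarrow>
        (\<forall>p\<in>W. P (\<lambda>q. scl E (of_real (f q)) (s q)) p =
           scl E (of_real (f p)) (P s p) - scl E 2 (D s p (gradient M f p))
           + scl E (of_real (box M f p)) (s p)))"


section \<open>Hadamard coefficients\<close>

definition rho ::
  "('m::topological_space, 'd::finite) spacetime \<Rightarrow> ('m, 'e::ab_group_add) cbundle \<Rightarrow>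
     (('m \<Rightarrow> 'e) \<Rightarrow> 'm \<Rightarrow> ('m, 'd) tangent \<Rightarrow> 'e) \<Rightarrow> 'm set \<Rightarrow>
     ('m \<Rightarrow> 'm \<Rightarrow> 'e \<Rightarrow> 'e) \<Rightarrow> 'm \<Rightarrow> 'm \<Rightarrow> 'e \<Rightarrow> 'e" where
  "rho M E D U V y x e =
     D (\<lambda>q. V q x e) y (gradient M (\<lambda>q. Gam M U q x) y)
     - scl E (of_real (box M (\<lambda>q. Gam M U q x) y / 2 - real CARD('d))) (V y x e)"

text \<open>The last clause normalizes \<open>V\<close> outside its domain, so that uniqueness makes sense for total
  functions.\<close>

definition hadamard_family ::
  "('m::topological_space, 'd::finite) spacetime \<Rightarrow> ('m, 'e::ab_group_add) cbundle \<Rightarrow>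
     (('m \<Rightarrow> 'e) \<Rightarrow> ('m \<Rightarrow> 'e)) \<Rightarrow> 'm set \<Rightarrow> (nat \<Rightarrow> 'm \<Rightarrow> 'm \<Rightarrow> 'e \<Rightarrow> 'e) \<Rightarrow> bool" where
  "hadamard_family M E P U V \<longleftrightarrow>
     (\<forall>k. smooth_kernel M E U (V k)) \<and>
     (\<exists>D. induced_connection M E P D \<and>
        (\<forall>k. \<forall>y\<in>U. \<forall>x\<in>U. \<forall>e\<in>fibre E x.
           rho M E D U (V k) y x e - scl E (of_nat (2 * k)) (V k y x e) =
           (if k = 0 then 0 else scl E (of_nat (2 * k)) (P (\<lambda>q. V (k - 1) q x e) y)))) \<and>
     (\<forall>x\<in>U. \<forall>e\<in>fibre E x. V 0 x x e = e) \<and>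
     (\<forall>k y x e. \<not> (y \<in> U \<and> x \<in> U \<and> e \<in> fibre E x) \<longrightarrow> V k y x e = 0)"

text \<open>The unique Hadamard family. It exists whenever \<open>P\<close> is normally hyperbolic and \<open>U\<close> is a GE
  set; the value \<open>0\<close> is a convention for other arguments.\<close>

definition hadamard_coeff ::
  "('m::topological_space, 'd::finite) spacetime \<Rightarrow> ('m, 'e::ab_group_add) cbundle \<Rightarrow>
     (('m \<Rightarrow> 'e) \<Rightarrow> ('m \<Rightarrow> 'e)) \<Rightarrow> 'm set \<Rightarrow> nat \<Rightarrow> 'm \<Rightarrow> 'm \<Rightarrow> 'e \<Rightarrow> 'e" where
  "hadamard_coeff M E P U =
     (if \<exists>!V. hadamard_family M E P U V then THE V. hadamard_family M E P U V
      else (\<lambda>k y x e. 0))"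

end

(* The binomial transform V |-> (k |-> sum_m (k choose m) z^m V^(k-m)) maps Hadamard families of P
   to Hadamard families of P - z, since both operators induce the same connection and the transport
   equations follow from absorption identities for binomial coefficients. It is injective, and its
   counterpart for -z leads back, so P has a unique Hadamard family iff P - z does. Existence of
   Hadamard families is not used. Applying the connection termwise requires grad Gamma to be a
   genuine tangent vector, hence Gamma to be differentiable, hence the domain of the exponential
   map in its definition to be unique. *)

theory Submission
  imports Defs
begin

section \<open>Calculus of smooth functions\<close>

text \<open>The binomial weights come from exponential generating series. For the formal series F(t)
  with terms V^k t^k / k!, the transport equations read (rho - 2 t d/dt) F = 2 t P F. The operator
  rho commutes with multiplication by exp(z t), while d/dt produces the extra term -2 t z exp(z t)
  F. Hence exp(z t) F solves the same equation with P - z in place of P, and its coefficients are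
  the asserted sums.

  Most of the work goes into justifying this computation for the encoded objects. Operators and
  connections are maps on total functions \<open>'m \<Rightarrow> 'e\<close> that are controlled
  only on smooth local sections, so linearity has to be derived there: for \<open>P\<close> from its
  coordinate form, for the connection from its axioms. Moreover \<open>gradient\<close>,
  \<open>exp_inv\<close> and \<open>frame\<close> are definite descriptions, whose values are known
  only after existence and uniqueness have been established. Finally \<open>hadamard_coeff\<close>
  is 0 by convention unless there is exactly one family; the identity must hold in that case too,
  which is why unique existence is transferred in both directions.\<close>

lemma Ck_on_cong:
  assumes "open S" "\<And>x. x \<in> S \<Longrightarrow> f x = g x" "Ck_on n S f"
  shows "Ck_on n S g"
  using assms(2,3)
proof (induction n arbitrary: f g)
  case 0
  then show ?case by (simp cong: continuous_on_cong)
next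
  case (Suc n)
  have "g differentiable (at x)" if "x \<in> S" for x
    using Suc.prems that \<open>open S\<close> has_derivative_transform_within_open[of f _ x UNIV S g]
    unfolding Ck_on.simps differentiable_def by blast
  moreover have "Ck_on n S (\<lambda>x. frechet_derivative g (at x) v)" for v
  proof (rule Suc.IH)
    show "frechet_derivative f (at x) v = frechet_derivative g (at x) v" if "x \<in> S" for x
      using frechet_derivative_transform_within_open[of f x S g] Suc.prems that \<open>open S\<close> by simp
    show "Ck_on n S (\<lambda>x. frechet_derivative f (at x) v)"
      using Suc.prems by simp
  qed
  ultimately show ?case by simp
qed

lemma smooth_on_cong:
  assumes "open S" "\<And>x. x \<in> S \<Longrightarrow> f x = g x" "smooth_on S f"
  shows "smooth_on S g"
  using assms Ck_on_cong unfolding smooth_on_def by blast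

text \<open>The recursion asks about \<open>frechet_derivative\<close> of the new function, for
  which a formula is known only at points of \<open>S\<close>; \<open>Ck_on_cong\<close> replaces it
  by that formula, to which the induction hypothesis applies. Sums and slices below follow the same
  pattern.\<close>

lemma Ck_on_linear:
  assumes "open S" "bounded_linear L" "Ck_on n S f"
  shows "Ck_on n S (\<lambda>x. L (f x))"
  using assms(3)
proof (induction n arbitrary: f)
  case 0
  then show ?case using assms(2) by (simp add: bounded_linear.continuous_on)
next
  case (Suc n)
  have *: "((\<lambda>x. L (f x)) has_derivative (\<lambda>v. L (frechet_derivative f (at x) v))) (at x)"
    if "x \<in> S" for x
    using Suc.prems that assms(2)
    by (auto intro: bounded_linear.has_derivative simp: frechet_derivative_works)
  have "Ck_on n S (\<lambda>x. frechet_derivative (\<lambda>x. L (f x)) (at x) v)" for v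
  proof (rule Ck_on_cong)
    show "Ck_on n S (\<lambda>x. L (frechet_derivative f (at x) v))"
      using Suc by simp
    show "L (frechet_derivative f (at x) v) = frechet_derivative (\<lambda>x. L (f x)) (at x) v"
      if "x \<in> S" for x
      using frechet_derivative_at[OF *[OF that]] by metis
  qed fact
  then show ?case using * by (auto simp: differentiable_def)
qed

lemma Ck_on_add:
  assumes "open S" "Ck_on n S f" "Ck_on n S g"
  shows "Ck_on n S (\<lambda>x. f x + g x)"
  using assms(2,3)
proof (induction n arbitrary: f g)
  case 0
  then show ?case by (simp add: continuous_on_add)
next
  case (Suc n)
  have *: "((\<lambda>x. f x + g x) has_derivative
      (\<lambda>v. frechet_derivative f (at x) v + frechet_derivative g (at x) v)) (at x)"
    if "x \<in> S" for x
    using Suc.prems that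
    by (auto intro: has_derivative_add simp: frechet_derivative_works)
  have "Ck_on n S (\<lambda>x. frechet_derivative (\<lambda>x. f x + g x) (at x) v)" for v
  proof (rule Ck_on_cong)
    show "Ck_on n S (\<lambda>x. frechet_derivative f (at x) v + frechet_derivative g (at x) v)"
      using Suc by simp
    show "frechet_derivative f (at x) v + frechet_derivative g (at x) v =
        frechet_derivative (\<lambda>x. f x + g x) (at x) v" if "x \<in> S" for x
      using frechet_derivative_at[OF *[OF that]] by metis
  qed fact
  then show ?case using * by (auto simp: differentiable_def)
qed

lemma Ck_on_const: "Ck_on n S (\<lambda>x. c)"
  by (induction n arbitrary: c) (simp_all add: frechet_derivative_const)

lemma smooth_on_const: "smooth_on S (\<lambda>x. c)"
  by (simp add: smooth_on_def Ck_on_const)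

lemma smooth_on_add:
  assumes "open S" "smooth_on S f" "smooth_on S g"
  shows "smooth_on S (\<lambda>x. f x + g x)"
  using assms by (simp add: smooth_on_def Ck_on_add)

text \<open>The coefficients are constants: binomial weights, or the coordinates of a fixed vector
  in a frame.\<close>

lemma smooth_on_lincomb:
  fixes f :: "'i \<Rightarrow> 'a::real_normed_vector \<Rightarrow> complex"
  assumes "open S" "\<And>i. i \<in> I \<Longrightarrow> smooth_on S (f i)"
  shows "smooth_on S (\<lambda>x. \<Sum>i\<in>I. a i * f i x)"
  using assms(2)
proof (induction I rule: infinite_finite_induct)
  case (insert i I)
  have "smooth_on S (\<lambda>x. a i * f i x)"
    using insert.prems[of i] Ck_on_linear[OF assms(1) bounded_linear_mult_right]
    unfolding smooth_on_def by blast
  then have "smooth_on S (\<lambda>x. a i * f i x + (\<Sum>i\<in>I. a i * f i x))"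
    using insert assms(1) by (intro smooth_on_add) auto
  with insert show ?case by simp
qed (simp_all add: smooth_on_const)

text \<open>The derivative of a slice in direction \<open>v\<close> is the slice of the derivative
  of \<open>F\<close> in direction \<open>(v, 0)\<close>, so the induction stays within slices. This
  is how a kernel, smooth in both points jointly, becomes a smooth section when one point is
  frozen.\<close>

lemma Ck_on_slice:
  fixes F :: "'a::real_normed_vector \<times> 'b::real_normed_vector \<Rightarrow> 'c::real_normed_vector"
  assumes "open A" "b \<in> B" "Ck_on n (A \<times> B) F"
  shows "Ck_on n A (\<lambda>u. F (u, b))"
  using assms(3)
proof (induction n arbitrary: F)
  case 0
  then show ?case using assms(2)
    by (auto intro!: continuous_on_compose2[of "A \<times> B" F A "\<lambda>u. (u, b)"] continuous_intros)
next
  case (Suc n)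
  have *: "((\<lambda>u. F (u, b)) has_derivative (\<lambda>v. frechet_derivative F (at (x, b)) (v, 0))) (at x)"
    if "x \<in> A" for x
  proof -
    have "(F has_derivative frechet_derivative F (at (x, b))) (at (x, b))"
      using Suc.prems that assms(2) by (auto simp: frechet_derivative_works)
    moreover have "((\<lambda>u. (u, b)) has_derivative (\<lambda>v. (v, 0))) (at x)"
      by (auto intro!: derivative_eq_intros)
    ultimately show ?thesis
      using has_derivative_compose[of "\<lambda>u. (u, b)" _ x UNIV F] by auto
  qed
  have "Ck_on n A (\<lambda>x. frechet_derivative (\<lambda>u. F (u, b)) (at x) v)" for v
  proof (rule Ck_on_cong)
    show "Ck_on n A (\<lambda>x. frechet_derivative F (at (x, b)) (v, 0))"
      using Suc.IH[of "\<lambda>p. frechet_derivative F (at p) (v, 0)"] Suc.prems by simp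
    show "frechet_derivative F (at (x, b)) (v, 0) = frechet_derivative (\<lambda>u. F (u, b)) (at x) v"
      if "x \<in> A" for x
      using frechet_derivative_at[OF *[OF that]] by metis
  qed fact
  then show ?case using * by (auto simp: differentiable_def)
qed

lemma smooth_on_slice:
  assumes "open A" "b \<in> B" "smooth_on (A \<times> B) F"
  shows "smooth_on A (\<lambda>u. F (u, b))"
  using assms by (simp add: smooth_on_def Ck_on_slice)

lemma smooth_on_differentiable:
  assumes "smooth_on S f" "x \<in> S"
  shows "f differentiable (at x)"
  using assms Ck_on.simps(2) unfolding smooth_on_def by blast

lemma smooth_on_frechet_derivative:
  assumes "smooth_on S f"
  shows "smooth_on S (\<lambda>x. frechet_derivative f (at x) v)"
  using assms Ck_on.simps(2) unfolding smooth_on_def by blast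


section \<open>Tangent spaces and gradients\<close>

locale lorentzian =
  fixes M :: "('m::topological_space, 'd::finite) spacetime"
  assumes atlas_M: "smooth_atlas (atlas M)"
    and metric_M: "lorentzian_metric M"
begin

lemma chart_inv_left:
  assumes "c \<in> atlas M" "p \<in> fst c"
  shows "chart_inv c (snd c p) = p"
proof -
  have "inj_on (snd c) (fst c)"
    using atlas_M assms(1) unfolding smooth_atlas_def homeomorphism_def
    by (metis (no_types, lifting) inj_on_def)
  then show ?thesis by (simp add: chart_inv_def assms(2))
qed

text \<open>Supplies the open coordinate domains on which the congruence lemmas exchange functions.
  Openness relative to the image of the chart is openness, as that image is itself open.\<close>

lemma open_chart_image:
  assumes "c \<in> atlas M" "open W"
  shows "open (snd c ` (fst c \<inter> W))"
proof -
  obtain \<psi> where h: "homeomorphism (fst c) (snd c ` fst c) (snd c) \<psi>"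
    and o: "open (snd c ` fst c)" "open (fst c)"
    using atlas_M assms(1) unfolding smooth_atlas_def by blast
  have "openin (top_of_set (fst c)) (fst c \<inter> W)"
    using assms(2) by (auto simp: openin_open)
  then have "openin (top_of_set (snd c ` fst c)) (snd c ` (fst c \<inter> W))"
    using h homeomorphism_imp_open_map by blast
  then show ?thesis using o openin_open_trans by blast
qed

lemma chart_around:
  obtains c where "c \<in> atlas M" "p \<in> fst c"
  using atlas_M unfolding smooth_atlas_def by blast

lemma linear_transition_derivative:
  assumes "c \<in> atlas M" "c' \<in> atlas M" "p \<in> fst c" "p \<in> fst c'"
  shows "linear (frechet_derivative (transition c c') (at (snd c p)))"
proof -
  have "smooth_on (snd c ` (fst c \<inter> fst c')) (transition c c')"
    using atlas_M assms(1,2) by (simp add: smooth_atlas_def)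
  then show ?thesis
    using smooth_on_differentiable[of _ "transition c c'" "snd c p"] assms
    by (intro linear_frechet_derivative) auto
qed

text \<open>The transformation rule recovers every component from those in one chart, and both sides
  vanish at arguments that are not charts around \<open>p\<close>. Tangent vectors may therefore be
  compared in a single chart.\<close>

lemma tvec_tangent:
  assumes "v \<in> tangent_space M p" "c \<in> atlas M" "p \<in> fst c"
  shows "tvec M c p (v c) = v"
proof
  fix c'
  show "tvec M c p (v c) c' = v c'"
  proof (cases "c' \<in> atlas M \<and> p \<in> fst c'")
    case True
    then have "v c' = frechet_derivative (transition c c') (at (snd c p)) (v c)"
      using assms unfolding tangent_space_def by blast
    with True show ?thesis by (simp add: tvec_def)
  next
    case False
    then have "v c' = 0"
      using assms(1) unfolding tangent_space_def by blast
    with False show ?thesis by (auto simp: tvec_def)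
  qed
qed

lemma tvec_scale:
  assumes "c \<in> atlas M" "p \<in> fst c"
  shows "tvec M c p (t *\<^sub>R w) = (\<lambda>c'. t *\<^sub>R tvec M c p w c')"
  using linear_scale[OF linear_transition_derivative[OF assms(1) _ assms(2)]]
  by (auto simp: tvec_def fun_eq_iff)

lemma tangent_eqI:
  assumes "v \<in> tangent_space M p" "w \<in> tangent_space M p" "c \<in> atlas M" "p \<in> fst c" "v c = w c"
  shows "v = w"
  using assms tvec_tangent by metis

lemma tangent_lincomb:
  assumes "\<And>i. i \<in> I \<Longrightarrow> v i \<in> tangent_space M p"
  shows "(\<lambda>c. \<Sum>i\<in>I. a i *\<^sub>R v i c) \<in> tangent_space M p"
  unfolding tangent_space_def
proof (intro CollectI allI conjI impI ballI)
  fix c c' assume c: "c \<in> atlas M \<and> p \<in> fst c" "c' \<in> atlas M" "p \<in> fst c'"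
  interpret linear "frechet_derivative (transition c c') (at (snd c p))"
    using linear_transition_derivative c by blast
  have "v i c' = frechet_derivative (transition c c') (at (snd c p)) (v i c)" if "i \<in> I" for i
    using assms[OF that] c unfolding tangent_space_def by blast
  then show "(\<Sum>i\<in>I. a i *\<^sub>R v i c') =
      frechet_derivative (transition c c') (at (snd c p)) (\<Sum>i\<in>I. a i *\<^sub>R v i c)"
    by (simp add: sum scale)
next
  fix c assume "\<not> (c \<in> atlas M \<and> p \<in> fst c)"
  then have "v i c = 0" if "i \<in> I" for i
    using assms[OF that] unfolding tangent_space_def by blast
  then show "(\<Sum>i\<in>I. a i *\<^sub>R v i c) = 0" by simp
qed

section \<open>Bilinearity of the metric, pseudo-orthonormal bases and gradients\<close>

lemma metric_sym:
  "\<lbrakk>v \<in> tangent_space M p; w \<in> tangent_space M p\<rbrakk> \<Longrightarrow> metric M p v w = metric M p w v"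
  using metric_M unfolding lorentzian_metric_def by blast

lemma metric_lincomb:
  assumes "\<And>i. i \<in> I \<Longrightarrow> v i \<in> tangent_space M p" "w \<in> tangent_space M p"
  shows "metric M p (\<lambda>c. \<Sum>i\<in>I. a i *\<^sub>R v i c) w = (\<Sum>i\<in>I. a i * metric M p (v i) w)"
proof -
  have lin: "metric M p (\<lambda>c. r *\<^sub>R u c + u' c) w = r * metric M p u w + metric M p u' w"
    if "u \<in> tangent_space M p" "u' \<in> tangent_space M p" for r u u'
    using metric_M that assms(2) unfolding lorentzian_metric_def by blast
  have "(\<lambda>c. 0) \<in> tangent_space M p"
    using tangent_lincomb[of "{}"] by simp
  \<comment> \<open>Linearity is given only in the combined form for \<open>r u + u'\<close>; its
    value at zero vectors reads t = t + t, which forces t = 0.\<close>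
  from lin[OF this this, of 1] have zero: "metric M p (\<lambda>c. 0) w = 0" by simp
  show ?thesis
    using assms(1)
  proof (induction I rule: infinite_finite_induct)
    case (insert i I)
    then show ?case using lin[OF _ tangent_lincomb[of I v p a]] by simp
  qed (simp_all add: zero)
qed

text \<open>The metric axiom provides as many pairwise orthogonal vectors as the dimension, but does
  not say that they span. Pairing with each of them gives independence because the squares are 1 or
  -1, and a dimension count then gives spanning. The coordinate functionals \<open>L j\<close> act
  on chart components, hence on \<open>real^'d\<close>, so that differentiability of coordinates
  makes sense.\<close>

lemma pseudo_orthonormal_basis:
  assumes "c \<in> atlas M" "p \<in> fst c"
  obtains b \<epsilon> L where "\<And>j. b j \<in> tangent_space M p"
    "\<And>i j. metric M p (b i) (b j) = (if i = j then \<epsilon> i else (0::real))" "\<And>j. \<epsilon> j * \<epsilon> j = 1"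
    "\<And>j. linear (L j)"
    "\<And>v. v \<in> tangent_space M p \<Longrightarrow> v = (\<lambda>c'. \<Sum>j\<in>(UNIV::'d set). L j (v c) *\<^sub>R b j c')"
proof -
  obtain i0 and b :: "'d \<Rightarrow> ('m, 'd) tangent" where b: "\<And>j. b j \<in> tangent_space M p"
    and m: "\<And>i j. metric M p (b i) (b j) = (if i \<noteq> j then 0 else if i = i0 then - 1 else 1)"
    using metric_M unfolding lorentzian_metric_def by metis
  define \<epsilon> where "\<epsilon> i = (if i = i0 then - 1 else 1 :: real)" for i
  have m\<epsilon>: "metric M p (b i) (b j) = (if i = j then \<epsilon> i else 0)" for i j
    by (simp add: m \<epsilon>_def)
  define A where "A a = (\<Sum>j\<in>UNIV. a $ j *\<^sub>R b j c)" for a :: "real^'d"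
  have A: "linear A"
    by (rule linearI)
      (simp_all add: A_def scaleR_left_distrib sum.distrib scaleR_sum_right)
  have "inj A"
    unfolding linear_injective_0[OF A]
  proof (intro allI impI)
    fix a assume "A a = 0"
    \<comment> \<open>The zero vector is written as a combination with coefficients 0, so that
      \<open>tangent_lincomb\<close> and \<open>metric_lincomb\<close> apply to both sides.\<close>
    then have "(\<lambda>c'. \<Sum>j\<in>UNIV. a $ j *\<^sub>R b j c') = (\<lambda>c'. \<Sum>j\<in>UNIV. 0 *\<^sub>R b j c')"
      using b by (intro tangent_eqI[OF tangent_lincomb tangent_lincomb assms]) (auto simp: A_def)
    then have "(\<Sum>j\<in>UNIV. a $ j * metric M p (b j) (b i)) = (\<Sum>j\<in>UNIV. 0 * metric M p (b j) (b i))" for i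
      using metric_lincomb[of UNIV b p "b i" "\<lambda>j. a $ j"] metric_lincomb[of UNIV b p "b i" "\<lambda>j. 0"] b
      by simp
    then have "a $ i * \<epsilon> i = 0" for i
      by (simp add: m\<epsilon> if_distrib[of "\<lambda>t. _ * t"] cong: if_cong)
    then have "a $ i = 0" for i
      by (metis \<epsilon>_def mult_eq_0_iff zero_neq_neg_one zero_neq_one)
    then show "a = 0" by (simp add: vec_eq_iff)
  qed
  then obtain g where g: "linear g" "A \<circ> g = id"
    using linear_injective_imp_surjective[OF A] linear_surjective_right_inverse[OF A] by blast
  show ?thesis
  proof (rule that[of b \<epsilon> "\<lambda>j w. g w $ j"])
    show "linear (\<lambda>w. g w $ j)" for j
      using g(1) by (auto intro!: linearI simp: linear_add linear_scale)
    fix v assume v: "v \<in> tangent_space M p"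
    have "v c = A (g (v c))" using g(2) by (metis comp_apply id_apply)
    then show "v = (\<lambda>c'. \<Sum>j\<in>UNIV. g (v c) $ j *\<^sub>R b j c')"
      using b by (intro tangent_eqI[OF v tangent_lincomb assms]) (auto simp: A_def)
  qed (auto simp: b m\<epsilon> \<epsilon>_def)
qed

text \<open>\<open>gradient\<close> is a definite description, so it lies in the tangent space once
  the vector representing df through the metric is shown to exist and to be unique.
  Differentiability makes \<open>differential\<close> linear, hence determined by its values on a
  basis.\<close>

lemma gradient_tangent:
  assumes "c = chart_at M p" "(f \<circ> chart_inv c) differentiable (at (snd c p))"
  shows "gradient M f p \<in> tangent_space M p"
proof -
  have c: "c \<in> atlas M" "p \<in> fst c"
    using someI_ex[of "\<lambda>c. c \<in> atlas M \<and> p \<in> fst c"] chart_around[of p]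
    unfolding assms(1) chart_at_def by metis+
  obtain b \<epsilon> L where b: "\<And>j. b j \<in> tangent_space M p"
    and m: "\<And>i j. metric M p (b i) (b j) = (if i = j then \<epsilon> i else (0::real))"
    and \<epsilon>: "\<And>j. \<epsilon> j * \<epsilon> j = 1"
    and "\<And>j. linear (L j)"
    and L: "\<And>v. v \<in> tangent_space M p \<Longrightarrow> v = (\<lambda>c'. \<Sum>j\<in>(UNIV::'d set). L j (v c) *\<^sub>R b j c')"
    by (rule pseudo_orthonormal_basis[OF c]) (rule that)
  let ?d = "differential M f p"
  have d: "?d (\<lambda>c. \<Sum>j\<in>UNIV. a j *\<^sub>R b j c) = (\<Sum>j\<in>UNIV. a j * ?d (b j))" for a
  proof -
    interpret linear "frechet_derivative (f \<circ> chart_inv c) (at (snd c p))"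
      using assms(2) by (rule linear_frechet_derivative)
    show ?thesis by (simp add: differential_def Let_def assms(1)[symmetric] sum scale)
  qed
  \<comment> \<open>This raises the index of df: the Gram matrix of \<open>b\<close> is diagonal
    with entries \<open>\<epsilon> j\<close>, and it is its own inverse because
    \<open>\<epsilon> j * \<epsilon> j = 1\<close>.\<close>
  define v where "v = (\<lambda>c. \<Sum>j\<in>UNIV. (\<epsilon> j * ?d (b j)) *\<^sub>R b j c)"
  have v: "v \<in> tangent_space M p" unfolding v_def by (rule tangent_lincomb[OF b])
  have vb: "metric M p v (b i) = ?d (b i)" for i
  proof -
    have "metric M p v (b i) = (\<Sum>j\<in>UNIV. \<epsilon> j * ?d (b j) * (if j = i then \<epsilon> j else 0))"
      unfolding v_def by (simp only: metric_lincomb[OF b b] m)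
    also have "\<dots> = (\<epsilon> i * \<epsilon> i) * ?d (b i)"
      by (simp add: if_distrib[of "\<lambda>t. _ * t"] cong: if_cong)
    finally show ?thesis by (simp add: \<epsilon>)
  qed
  have expand: "metric M p u w = (\<Sum>j\<in>UNIV. L j (w c) * metric M p u (b j))"
    if "u \<in> tangent_space M p" "w \<in> tangent_space M p" for u w
  proof -
    have "metric M p u w = metric M p (\<lambda>c'. \<Sum>j\<in>UNIV. L j (w c) *\<^sub>R b j c') u"
      using metric_sym[OF that] L[OF that(2)] by simp
    also have "\<dots> = (\<Sum>j\<in>UNIV. L j (w c) * metric M p u (b j))"
      by (simp add: metric_lincomb[OF b that(1)] metric_sym[OF b that(1)])
    finally show ?thesis .
  qed
  have coord: "metric M p u (b i) = L i (u c) * \<epsilon> i" if u: "u \<in> tangent_space M p" for u i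
  proof -
    have "metric M p u (b i) = metric M p (\<lambda>c'. \<Sum>j\<in>UNIV. L j (u c) *\<^sub>R b j c') (b i)"
      using L[OF u] by simp
    also have "\<dots> = L i (u c) * \<epsilon> i"
      by (simp add: metric_lincomb[OF b b] m if_distrib[of "\<lambda>t. _ * t"] cong: if_cong)
    finally show ?thesis .
  qed
  have "gradient M f p = v"
    unfolding gradient_def
  proof (rule the_equality)
    have "metric M p v w = ?d w" if "w \<in> tangent_space M p" for w
      using expand[OF v that] d[of "\<lambda>j. L j (w c)"] L[OF that] by (simp add: vb)
    then show "v \<in> tangent_space M p \<and> (\<forall>w\<in>tangent_space M p. metric M p v w = ?d w)"
      using v by blast
    fix u assume u: "u \<in> tangent_space M p \<and> (\<forall>w\<in>tangent_space M p. metric M p u w = ?d w)"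
    then have "L i (u c) * \<epsilon> i = L i (v c) * \<epsilon> i" for i
      using coord[of u i] coord[OF v, of i] vb[of i] b by simp
    then have "L i (u c) = L i (v c)" for i
      using \<epsilon>[of i] by (metis mult_cancel_right mult_zero_left zero_neq_one)
    then have "(\<lambda>c'. \<Sum>j\<in>UNIV. L j (u c) *\<^sub>R b j c') = (\<lambda>c'. \<Sum>j\<in>UNIV. L j (v c) *\<^sub>R b j c')"
      by simp
    then show "u = v" using L[of u] L[OF v] u by simp
  qed
  then show ?thesis using v by simp
qed

section \<open>Uniqueness of the normal domain and differentiability of \<open>Gam\<close>\<close>

lemma smooth_fun_continuous:
  assumes "smooth_fun M W f" "open W"
  shows "continuous_on W f"
proof -
  have "continuous_on (fst c \<inter> W) f" if c: "c \<in> atlas M" for c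
  proof -
    have "continuous_on (snd c ` (fst c \<inter> W)) (f \<circ> chart_inv c)"
      using assms(1) c unfolding smooth_fun_def smooth_on_def by (metis Ck_on.simps(1))
    moreover have "continuous_on (fst c \<inter> W) (snd c)"
      using atlas_M c unfolding smooth_atlas_def homeomorphism_def
      by (meson continuous_on_subset inf_le1)
    ultimately have "continuous_on (fst c \<inter> W) (\<lambda>q. (f \<circ> chart_inv c) (snd c q))"
      using continuous_on_compose2 by blast
    then show ?thesis
      by (rule continuous_on_eq) (simp add: chart_inv_left[OF c])
  qed
  moreover have "open (fst c \<inter> W)" if "c \<in> atlas M" for c
    using that atlas_M assms(2) unfolding smooth_atlas_def by blast
  ultimately have "continuous_on (\<Union>c\<in>atlas M. fst c \<inter> W) f"
    by (intro continuous_on_open_UN) auto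
  moreover have "(\<Union>c\<in>atlas M. fst c \<inter> W) = W"
    using atlas_M unfolding smooth_atlas_def by blast
  ultimately show ?thesis by simp
qed

text \<open>The ray from \<open>0\<close> to \<open>v\<close> stays in \<open>\<Omega>'\<close> since it agrees with the lift to \<open>\<Omega>'\<close> of its image
  under the exponential map on an open and closed set of parameters.\<close>

lemma normal_domain_subset:
  assumes U: "open U" and \<Omega>: "normal_domain M U x \<Omega>" and \<Omega>': "normal_domain M U x \<Omega>'"
  shows "\<Omega> \<subseteq> \<Omega>'"
proof
  fix v assume v: "v \<in> \<Omega>"
  obtain c where c: "c \<in> atlas M" "x \<in> fst c" by (rule chart_around)
  define F where "F w = exp_map M x (tvec M c x w)" for w
  define B where "B = {w. tvec M c x w \<in> \<Omega>}"
  define B' where "B' = {w. tvec M c x w \<in> \<Omega>'}"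
  define G where "G q = inv_into \<Omega>' (exp_map M x) q c" for q
  have F: "continuous_on B F" and B': "open B'" and "smooth_fun M U G"
    using \<Omega> \<Omega>' c unfolding normal_domain_def F_def[abs_def] B_def B'_def G_def[abs_def] Let_def
    by blast+
  then have G: "continuous_on U G" using smooth_fun_continuous U by blast
  have T: "\<Omega> \<subseteq> tangent_space M x" "\<Omega>' \<subseteq> tangent_space M x"
    using \<Omega> \<Omega>' unfolding normal_domain_def exp_dom_def by blast+
  have bij: "bij_betw (exp_map M x) \<Omega> U" "bij_betw (exp_map M x) \<Omega>' U"
    using \<Omega> \<Omega>' unfolding normal_domain_def by blast+
  have tv: "tvec M c x (t *\<^sub>R v c) = (\<lambda>c. t *\<^sub>R v c)" for t
    using tvec_scale[OF c] tvec_tangent[OF _ c] v T by auto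
  have ray: "(\<lambda>c. t *\<^sub>R v c) \<in> \<Omega>" if "t \<in> {0..1}" for t
    using \<Omega> v that unfolding normal_domain_def by blast
  have FU: "F (t *\<^sub>R v c) \<in> U" if "t \<in> {0..1}" for t
    using ray[OF that] bij_betwE[OF bij(1)] by (simp add: F_def tv)
  have cont: "continuous_on {0..1} (\<lambda>t. G (F (t *\<^sub>R v c)))"
  proof (rule continuous_on_compose2[OF G])
    show "continuous_on {0..1} (\<lambda>t. F (t *\<^sub>R v c))"
      using ray by (intro continuous_on_compose2[OF F] continuous_intros) (auto simp: B_def tv)
  qed (use FU in auto)
  define S where "S = {t \<in> {0..1}. G (F (t *\<^sub>R v c)) = t *\<^sub>R v c}"
  \<comment> \<open>Two descriptions of the same set of parameters: as the coincidence set of two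
    continuous maps it is closed, as a preimage of the open set \<open>B'\<close> it is
    open.\<close>
  have S_eq: "S = {t \<in> {0..1}. t *\<^sub>R v c \<in> B'}"
  proof -
    have "G (F (t *\<^sub>R v c)) = t *\<^sub>R v c \<longleftrightarrow> t *\<^sub>R v c \<in> B'" if t: "t \<in> {0..1}" for t
    proof
      let ?w = "inv_into \<Omega>' (exp_map M x) (F (t *\<^sub>R v c))"
      assume "G (F (t *\<^sub>R v c)) = t *\<^sub>R v c"
      moreover have w: "?w \<in> \<Omega>'"
        using FU[OF t] bij(2) by (metis bij_betw_imp_surj_on inv_into_into)
      ultimately have "tvec M c x (t *\<^sub>R v c) = ?w"
        using tvec_tangent[OF _ c, of ?w] T(2) by (auto simp: G_def)
      then show "t *\<^sub>R v c \<in> B'" using w by (simp add: B'_def)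
    next
      assume "t *\<^sub>R v c \<in> B'"
      then show "G (F (t *\<^sub>R v c)) = t *\<^sub>R v c"
        using inv_into_f_f[OF bij_betw_imp_inj_on[OF bij(2)]] by (simp add: G_def F_def B'_def tv)
    qed
    then show ?thesis by (auto simp: S_def)
  qed
  have "openin (top_of_set {0..1}) S"
  proof -
    have "open ((\<lambda>t. t *\<^sub>R v c) -` B')"
      by (intro continuous_open_vimage B' continuous_intros)
    then show ?thesis unfolding S_eq openin_open by blast
  qed
  moreover have "closedin (top_of_set {0..1}) S"
    using continuous_closedin_preimage_constant[of "{0..1}" "\<lambda>t. G (F (t *\<^sub>R v c)) - t *\<^sub>R v c" 0]
      continuous_on_diff[OF cont, of "\<lambda>t. t *\<^sub>R v c"]
    by (simp add: S_def continuous_intros)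
  moreover have "0 \<in> S"
    using \<Omega>' tv[of 0] unfolding S_eq B'_def normal_domain_def by simp
  ultimately have "S = {0..1}"
    using connected_Icc[of 0 "1::real"] unfolding connected_clopen by blast
  then have "v c \<in> B'" using S_eq by force
  then show "v \<in> \<Omega>'" using tv[of 1] by (simp add: B'_def)
qed

text \<open>Exchanging the roles of two normal domains turns the inclusion above into equality, so
  the definite description in \<open>exp_inv\<close> denotes \<open>\<Omega>\<close>.\<close>

lemma exp_inv_eq:
  assumes "open U" "normal_domain M U x \<Omega>"
  shows "exp_inv M U x = inv_into \<Omega> (exp_map M x)"
proof -
  have "(THE \<Omega>. normal_domain M U x \<Omega>) = \<Omega>"
    using normal_domain_subset assms by (intro the_equality) blast+
  then show ?thesis by (simp add: exp_inv_def fun_eq_iff)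
qed

text \<open>In a pseudo-orthonormal basis at \<open>x\<close>, the metric is a diagonal quadratic
  form in the functionals \<open>L j\<close>. Thus \<open>Gam\<close> is, on \<open>U\<close>, a
  quadratic polynomial in the chart components of the inverse exponential map, and these are smooth
  by the definition of a normal domain.\<close>

lemma gradient_Gam_tangent:
  assumes "GE_set M U" "x \<in> U" "y \<in> U"
  shows "gradient M (\<lambda>q. Gam M U q x) y \<in> tangent_space M y"
proof (rule gradient_tangent[OF refl])
  define c' where "c' = chart_at M y"
  have c': "c' \<in> atlas M" "y \<in> fst c'"
    using someI_ex[of "\<lambda>c. c \<in> atlas M \<and> y \<in> fst c"] chart_around[of y]
    unfolding c'_def chart_at_def by metis+
  obtain c where c: "c \<in> atlas M" "x \<in> fst c" by (rule chart_around)
  obtain \<Omega> where U: "open U" and \<Omega>: "normal_domain M U x \<Omega>"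
    using assms unfolding GE_set_def by blast
  obtain b \<epsilon> L where b: "\<And>j. b j \<in> tangent_space M x"
    and m: "\<And>i j. metric M x (b i) (b j) = (if i = j then \<epsilon> i else (0::real))"
    and "\<And>j. \<epsilon> j * \<epsilon> j = 1"
    and lin: "\<And>j. linear (L j)"
    and L: "\<And>v. v \<in> tangent_space M x \<Longrightarrow> v = (\<lambda>c'. \<Sum>j\<in>(UNIV::'d set). L j (v c) *\<^sub>R b j c')"
    by (rule pseudo_orthonormal_basis[OF c]) (rule that)
  let ?\<iota> = "inv_into \<Omega> (exp_map M x)"
  have "smooth_fun M U (\<lambda>q. ?\<iota> q c)"
    using \<Omega> c unfolding normal_domain_def Let_def by blast
  then have h: "(\<lambda>u. ?\<iota> (chart_inv c' u) c) differentiable (at (snd c' y))"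
    using c' assms smooth_on_differentiable unfolding smooth_fun_def comp_def by blast
  have sq: "metric M x v v = (\<Sum>j\<in>UNIV. \<epsilon> j * L j (v c) * L j (v c))"
    if v: "v \<in> tangent_space M x" for v
  proof -
    have vb: "metric M x v (b i) = L i (v c) * \<epsilon> i" for i
    proof -
      have "metric M x v (b i) = metric M x (\<lambda>c'. \<Sum>j\<in>UNIV. L j (v c) *\<^sub>R b j c') (b i)"
        using L[OF v] by simp
      also have "\<dots> = L i (v c) * \<epsilon> i"
        by (simp add: metric_lincomb[OF b b] m if_distrib[of "\<lambda>t. _ * t"] cong: if_cong)
      finally show ?thesis .
    qed
    have "metric M x v v = metric M x (\<lambda>c'. \<Sum>j\<in>UNIV. L j (v c) *\<^sub>R b j c') v"
      using L[OF v] by simp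
    then show ?thesis
      by (simp add: metric_lincomb[OF b v] metric_sym[OF b v] vb mult_ac)
  qed
  have Gam: "Gam M U q x = - (\<Sum>j\<in>UNIV. \<epsilon> j * L j (?\<iota> q c) * L j (?\<iota> q c))" if "q \<in> U" for q
  proof -
    have "exp_map M x ` \<Omega> = U" and "\<Omega> \<subseteq> tangent_space M x"
      using \<Omega> unfolding normal_domain_def exp_dom_def bij_betw_def by blast+
    then have "?\<iota> q \<in> tangent_space M x"
      using inv_into_into[of q "exp_map M x" \<Omega>] that by blast
    then show ?thesis by (simp add: Gam_def exp_inv_eq[OF U \<Omega>] sq)
  qed
  have "(\<lambda>u. L j (?\<iota> (chart_inv c' u) c)) differentiable (at (snd c' y))" for j
    using differentiable_compose[OF linear_imp_differentiable[OF lin] h] .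
  then have "(\<lambda>u. - (\<Sum>j\<in>UNIV. \<epsilon> j * L j (?\<iota> (chart_inv c' u) c) * L j (?\<iota> (chart_inv c' u) c)))
      differentiable (at (snd c' y))"
    by (intro differentiable_minus differentiable_sum differentiable_mult) auto
  then obtain f' where f': "((\<lambda>u. - (\<Sum>j\<in>UNIV. \<epsilon> j * L j (?\<iota> (chart_inv c' u) c) *
      L j (?\<iota> (chart_inv c' u) c))) has_derivative f') (at (snd c' y))"
    unfolding differentiable_def by blast
  have "((\<lambda>q. Gam M U q x) \<circ> chart_inv c' has_derivative f') (at (snd c' y))"
  proof (rule has_derivative_transform_within_open[OF f'])
    show "open (snd c' ` (fst c' \<inter> U))" using open_chart_image[OF c'(1) U] .
  qed (use c' assms Gam chart_inv_left[OF c'(1)] in auto)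
  then show "((\<lambda>q. Gam M U q x) \<circ> chart_inv (chart_at M y)) differentiable at (snd (chart_at M y) y)"
    unfolding c'_def[symmetric] by (rule differentiableI)
qed

end


section \<open>Smooth sections of a vector bundle\<close>

locale bundle_over_manifold = lorentzian M
  for M :: "('m::topological_space, 'd::finite) spacetime" +
  fixes E :: "('m, 'e::ab_group_add) cbundle"
  assumes bundle_E: "complex_vector_bundle M E"
begin

sublocale vector_space "scl E"
  using bundle_E by (simp add: complex_vector_bundle_def)

lemma fibre_subspace: "subspace (fibre E p)"
  using bundle_E by (simp add: complex_vector_bundle_def)

lemma fibre_lincomb:
  assumes "\<And>i. i \<in> I \<Longrightarrow> s i \<in> fibre E p"
  shows "(\<Sum>i\<in>I. scl E (a i) (s i)) \<in> fibre E p"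
  using assms by (intro subspace_sum subspace_scale fibre_subspace)

lemma triv_around:
  obtains B \<Phi> where "(B, \<Phi>) \<in> trivs E" "p \<in> B"
proof -
  have "(\<Union>(B, \<Phi>)\<in>trivs E. B) = UNIV"
    using bundle_E by (simp add: complex_vector_bundle_def)
  then have "p \<in> (\<Union>(B, \<Phi>)\<in>trivs E. B)" by simp
  then show ?thesis using that by auto
qed

lemma
  assumes "(B, \<Phi>) \<in> trivs E"
  shows triv_open: "open B"
    and triv_linear: "\<lbrakk>p \<in> B; e \<in> fibre E p; e' \<in> fibre E p; i < rk E\<rbrakk> \<Longrightarrow>
      \<Phi> p (scl E a e + e') i = a * \<Phi> p e i + \<Phi> p e' i"
    and triv_bij: "p \<in> B \<Longrightarrow>
      bij_betw (\<lambda>e. restrict (\<Phi> p e) {..<rk E}) (fibre E p) ({..<rk E} \<rightarrow>\<^sub>E UNIV)"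
proof -
  have "\<forall>(B, \<Phi>)\<in>trivs E. open B \<and> (\<forall>p\<in>B.
        (\<forall>a. \<forall>e\<in>fibre E p. \<forall>e'\<in>fibre E p. \<forall>i<rk E.
           \<Phi> p (scl E a e + e') i = a * \<Phi> p e i + \<Phi> p e' i) \<and>
        bij_betw (\<lambda>e. restrict (\<Phi> p e) {..<rk E}) (fibre E p) ({..<rk E} \<rightarrow>\<^sub>E UNIV))"
    using bundle_E unfolding complex_vector_bundle_def by (elim conjE)
  from bspec[OF this assms] have *: "open B \<and> (\<forall>p\<in>B.
        (\<forall>a. \<forall>e\<in>fibre E p. \<forall>e'\<in>fibre E p. \<forall>i<rk E.
           \<Phi> p (scl E a e + e') i = a * \<Phi> p e i + \<Phi> p e' i) \<and>
        bij_betw (\<lambda>e. restrict (\<Phi> p e) {..<rk E}) (fibre E p) ({..<rk E} \<rightarrow>\<^sub>E UNIV))"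
    unfolding prod.case .
  show "open B" using * by (rule conjunct1)
  show "\<Phi> p (scl E a e + e') i = a * \<Phi> p e i + \<Phi> p e' i"
    if "p \<in> B" "e \<in> fibre E p" "e' \<in> fibre E p" "i < rk E"
    using * that by blast
  show "bij_betw (\<lambda>e. restrict (\<Phi> p e) {..<rk E}) (fibre E p) ({..<rk E} \<rightarrow>\<^sub>E UNIV)"
    if "p \<in> B"
    using * that by blast
qed

lemma triv_lincomb:
  assumes "(B, \<Phi>) \<in> trivs E" "p \<in> B" "i < rk E" "\<And>j. j \<in> I \<Longrightarrow> s j \<in> fibre E p"
  shows "\<Phi> p (\<Sum>j\<in>I. scl E (a j) (s j)) i = (\<Sum>j\<in>I. a j * \<Phi> p (s j) i)"
proof -
  have zero: "\<Phi> p 0 i = 0"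
    using triv_linear[OF assms(1,2) subspace_0[OF fibre_subspace] subspace_0[OF fibre_subspace]
        assms(3), of 1] by simp
  show ?thesis
    using assms(4)
  proof (induction I rule: infinite_finite_induct)
    case (insert j I)
    have "\<Phi> p (scl E (a j) (s j) + (\<Sum>j\<in>I. scl E (a j) (s j))) i =
        a j * \<Phi> p (s j) i + \<Phi> p (\<Sum>j\<in>I. scl E (a j) (s j)) i"
      using insert.prems by (intro triv_linear[OF assms(1,2) _ _ assms(3)] fibre_lincomb) auto
    also have "\<Phi> p (\<Sum>j\<in>I. scl E (a j) (s j)) i = (\<Sum>j\<in>I. a j * \<Phi> p (s j) i)"
      using insert.prems by (intro insert.IH) auto
    finally show ?case using insert.hyps by simp
  qed (simp_all add: zero)
qed

lemma triv_eqI: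
  assumes "(B, \<Phi>) \<in> trivs E" "p \<in> B" "e \<in> fibre E p" "e' \<in> fibre E p"
    and "\<And>i. i < rk E \<Longrightarrow> \<Phi> p e i = \<Phi> p e' i"
  shows "e = e'"
proof (rule inj_onD[OF bij_betw_imp_inj_on[OF triv_bij[OF assms(1,2)]]])
  show "restrict (\<Phi> p e) {..<rk E} = restrict (\<Phi> p e') {..<rk E}"
    using assms(5) by (intro restrict_ext) simp
qed fact+

text \<open>Surjectivity of the trivialization onto tuples gives a vector with the prescribed
  coordinates, and injectivity gives its uniqueness; together they evaluate the definite description
  in \<open>frame\<close>. For \<open>j\<close> beyond the rank, all coordinates are 0.\<close>

lemma frame:
  assumes "(B, \<Phi>) \<in> trivs E" "p \<in> B"
  shows frame_in_fibre: "frame E \<Phi> j p \<in> fibre E p"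
    and triv_frame: "i < rk E \<Longrightarrow> \<Phi> p (frame E \<Phi> j p) i = (if i = j then 1 else 0)"
proof -
  have "restrict (\<lambda>i. if i = j then 1 else 0) {..<rk E} \<in>
      (\<lambda>e. restrict (\<Phi> p e) {..<rk E}) ` fibre E p"
    by (simp add: bij_betw_imp_surj_on[OF triv_bij[OF assms]])
  then obtain e where eq: "restrict (\<lambda>i. if i = j then 1 else 0) {..<rk E} = restrict (\<Phi> p e) {..<rk E}"
    and e: "e \<in> fibre E p"
    by blast
  have "\<Phi> p e i = (if i = j then 1 else 0)" if "i < rk E" for i
    using fun_cong[OF eq, of i] that by simp
  then have "\<exists>!e. e \<in> fibre E p \<and> (\<forall>i<rk E. \<Phi> p e i = (if i = j then 1 else 0))"
    using e by (intro ex1I[of _ e] conjI triv_eqI[OF assms]) auto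
  from theI'[OF this] show "frame E \<Phi> j p \<in> fibre E p"
    "i < rk E \<Longrightarrow> \<Phi> p (frame E \<Phi> j p) i = (if i = j then 1 else 0)"
    unfolding frame_def by auto
qed

lemma frame_expansion:
  assumes "(B, \<Phi>) \<in> trivs E" "p \<in> B" "e \<in> fibre E p"
  shows "e = (\<Sum>j<rk E. scl E (\<Phi> p e j) (frame E \<Phi> j p))"
proof (rule triv_eqI[OF assms(1,2,3)])
  show "(\<Sum>j<rk E. scl E (\<Phi> p e j) (frame E \<Phi> j p)) \<in> fibre E p"
    using frame_in_fibre[OF assms(1,2)] by (intro fibre_lincomb)
  show "\<Phi> p e i = \<Phi> p (\<Sum>j<rk E. scl E (\<Phi> p e j) (frame E \<Phi> j p)) i" if "i < rk E" for i
    using triv_lincomb[OF assms(1,2) that, of "{..<rk E}"] triv_frame[OF assms(1,2) that] that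
      frame_in_fibre[OF assms(1,2)]
    by (simp add: if_distrib[of "\<lambda>t. _ * t"] sum.delta' cong: if_cong)
qed

lemma smooth_section_coordinate:
  assumes "smooth_section M E W s" "(B, \<Phi>) \<in> trivs E" "i < rk E" "c \<in> atlas M"
  shows "smooth_on (snd c ` (fst c \<inter> (W \<inter> B))) ((\<lambda>p. \<Phi> p (s p) i) \<circ> chart_inv c)"
  using assms unfolding smooth_section_def smooth_fun_def by blast

lemma smooth_section_lincomb:
  assumes "open W" "\<And>m. m \<in> I \<Longrightarrow> smooth_section M E W (s m)"
  shows "smooth_section M E W (\<lambda>q. \<Sum>m\<in>I. scl E (a m) (s m q))"
proof -
  have fib: "s m p \<in> fibre E p" if "m \<in> I" "p \<in> W" for m p
    using assms(2) that unfolding smooth_section_def by blast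
  have "smooth_on (snd c ` (fst c \<inter> (W \<inter> B)))
      ((\<lambda>p. \<Phi> p (\<Sum>m\<in>I. scl E (a m) (s m p)) i) \<circ> chart_inv c)"
    if B: "(B, \<Phi>) \<in> trivs E" and i: "i < rk E" and c: "c \<in> atlas M" for B \<Phi> i c
  proof (rule smooth_on_cong)
    show "open (snd c ` (fst c \<inter> (W \<inter> B)))"
      by (intro open_chart_image c open_Int assms(1) triv_open[OF B])
    then show "smooth_on (snd c ` (fst c \<inter> (W \<inter> B)))
        (\<lambda>u. \<Sum>m\<in>I. a m * ((\<lambda>p. \<Phi> p (s m p) i) \<circ> chart_inv c) u)"
      by (intro smooth_on_lincomb smooth_section_coordinate assms(2) B i c)
    show "(\<Sum>m\<in>I. a m * ((\<lambda>p. \<Phi> p (s m p) i) \<circ> chart_inv c) u) =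
        ((\<lambda>p. \<Phi> p (\<Sum>m\<in>I. scl E (a m) (s m p)) i) \<circ> chart_inv c) u"
      if "u \<in> snd c ` (fst c \<inter> (W \<inter> B))" for u
      using that fib chart_inv_left[OF c] triv_lincomb[OF B _ i, of _ I "\<lambda>m. s m _" a] by auto
  qed
  moreover have "(\<Sum>m\<in>I. scl E (a m) (s m p)) \<in> fibre E p" if "p \<in> W" for p
    using fib that by (intro fibre_lincomb)
  ultimately show ?thesis
    unfolding smooth_section_def smooth_fun_def by auto
qed

lemma smooth_kernel_linear:
  assumes "smooth_kernel M E U V" "y \<in> U" "x \<in> U" "\<And>j. j \<in> I \<Longrightarrow> f j \<in> fibre E x"
  shows "V y x (\<Sum>j\<in>I. scl E (a j) (f j)) = (\<Sum>j\<in>I. scl E (a j) (V y x (f j)))"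
proof -
  have lin: "V y x (scl E a e + e') = scl E a (V y x e) + V y x e'"
    if "e \<in> fibre E x" "e' \<in> fibre E x" for a e e'
    using assms(1-3) that unfolding smooth_kernel_def by blast
  have zero: "V y x 0 = 0"
    using lin[OF subspace_0[OF fibre_subspace] subspace_0[OF fibre_subspace], of 1] by simp
  show ?thesis
    using assms(4)
  proof (induction I rule: infinite_finite_induct)
    case (insert j I)
    then show ?case using lin fibre_lincomb[of I f x a] by simp
  qed (simp_all add: zero)
qed

lemma smooth_kernel_fibre:
  "\<lbrakk>smooth_kernel M E U V; y \<in> U; x \<in> U; e \<in> fibre E x\<rbrakk> \<Longrightarrow> V y x e \<in> fibre E y"
  unfolding smooth_kernel_def by blast

lemma smooth_kernel_entries:
  assumes "smooth_kernel M E U V" "c \<in> atlas M" "c' \<in> atlas M"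
    "(B, \<Phi>) \<in> trivs E" "(B', \<Phi>') \<in> trivs E" "i < rk E" "j < rk E"
  shows "smooth_on ((snd c ` (fst c \<inter> B \<inter> U)) \<times> (snd c' ` (fst c' \<inter> B' \<inter> U)))
    (\<lambda>(a, b). \<Phi> (chart_inv c a) (V (chart_inv c a) (chart_inv c' b)
       (frame E \<Phi>' j (chart_inv c' b))) i)"
proof -
  have "\<forall>c\<in>atlas M. \<forall>c'\<in>atlas M. \<forall>(B, \<Phi>)\<in>trivs E. \<forall>(B', \<Phi>')\<in>trivs E.
        \<forall>i<rk E. \<forall>j<rk E.
        smooth_on ((snd c ` (fst c \<inter> B \<inter> U)) \<times> (snd c' ` (fst c' \<inter> B' \<inter> U)))
          (\<lambda>(a, b). \<Phi> (chart_inv c a) (V (chart_inv c a) (chart_inv c' b)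
            (frame E \<Phi>' j (chart_inv c' b))) i)"
    using assms(1) unfolding smooth_kernel_def Let_def by (elim conjE)
  then show ?thesis using assms(2-) by blast
qed

text \<open>\<open>smooth_kernel\<close> controls matrix entries with respect to a frame that varies
  with \<open>x\<close>. With \<open>x\<close> frozen, \<open>e\<close> is a constant combination of
  frame vectors, so the coordinates of the section are constant combinations of slices of matrix
  entries.\<close>

lemma smooth_kernel_section:
  assumes V: "smooth_kernel M E U V" and U: "open U" and x: "x \<in> U" "e \<in> fibre E x"
  shows "smooth_section M E U (\<lambda>q. V q x e)"
proof -
  obtain c' where c': "c' \<in> atlas M" "x \<in> fst c'" by (rule chart_around)
  obtain B' \<Phi>' where B': "(B', \<Phi>') \<in> trivs E" "x \<in> B'" by (rule triv_around)
  have "smooth_on (snd c ` (fst c \<inter> (U \<inter> B))) ((\<lambda>p. \<Phi> p (V p x e) i) \<circ> chart_inv c)"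
    if B: "(B, \<Phi>) \<in> trivs E" and i: "i < rk E" and c: "c \<in> atlas M" for B \<Phi> i c
  proof (rule smooth_on_cong)
    show o: "open (snd c ` (fst c \<inter> (U \<inter> B)))"
      by (intro open_chart_image c open_Int U triv_open[OF B])
    show "smooth_on (snd c ` (fst c \<inter> (U \<inter> B)))
        (\<lambda>u. \<Sum>j<rk E. \<Phi>' x e j * \<Phi> (chart_inv c u) (V (chart_inv c u) x (frame E \<Phi>' j x)) i)"
    proof (rule smooth_on_lincomb[OF o])
      fix j assume "j \<in> {..<rk E}"
      then have "smooth_on ((snd c ` (fst c \<inter> B \<inter> U)) \<times> (snd c' ` (fst c' \<inter> B' \<inter> U)))
        (\<lambda>(a, b). \<Phi> (chart_inv c a) (V (chart_inv c a) (chart_inv c' b)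
           (frame E \<Phi>' j (chart_inv c' b))) i)"
        using smooth_kernel_entries[OF V c c'(1) B B'(1) i] by simp
      moreover have "fst c \<inter> B \<inter> U = fst c \<inter> (U \<inter> B)" by blast
      ultimately have "smooth_on ((snd c ` (fst c \<inter> (U \<inter> B))) \<times> (snd c' ` (fst c' \<inter> B' \<inter> U)))
        (\<lambda>(a, b). \<Phi> (chart_inv c a) (V (chart_inv c a) (chart_inv c' b)
           (frame E \<Phi>' j (chart_inv c' b))) i)"
        by (simp only:)
      moreover have "snd c' x \<in> snd c' ` (fst c' \<inter> B' \<inter> U)" using c' B' x by blast
      ultimately have "smooth_on (snd c ` (fst c \<inter> (U \<inter> B)))
          (\<lambda>u. case (u, snd c' x) of (a, b) \<Rightarrow> \<Phi> (chart_inv c a) (V (chart_inv c a)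
            (chart_inv c' b) (frame E \<Phi>' j (chart_inv c' b))) i)"
        by (intro smooth_on_slice[OF o])
      then show "smooth_on (snd c ` (fst c \<inter> (U \<inter> B)))
          (\<lambda>u. \<Phi> (chart_inv c u) (V (chart_inv c u) x (frame E \<Phi>' j x)) i)"
        by (simp only: prod.case chart_inv_left[OF c'])
    qed
    show "(\<Sum>j<rk E. \<Phi>' x e j * \<Phi> (chart_inv c u) (V (chart_inv c u) x (frame E \<Phi>' j x)) i) =
        ((\<lambda>p. \<Phi> p (V p x e) i) \<circ> chart_inv c) u" if "u \<in> snd c ` (fst c \<inter> (U \<inter> B))" for u
    proof -
      from that obtain p where p: "p \<in> U" "p \<in> B" "chart_inv c u = p"
        using chart_inv_left[OF c] by auto
      have "V p x e = V p x (\<Sum>j<rk E. scl E (\<Phi>' x e j) (frame E \<Phi>' j x))"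
        using frame_expansion[OF B' x(2)] by simp
      also have "\<dots> = (\<Sum>j<rk E. scl E (\<Phi>' x e j) (V p x (frame E \<Phi>' j x)))"
        by (rule smooth_kernel_linear[OF V p(1) x(1) frame_in_fibre[OF B']])
      also have "\<Phi> p \<dots> i = (\<Sum>j<rk E. \<Phi>' x e j * \<Phi> p (V p x (frame E \<Phi>' j x)) i)"
        by (rule triv_lincomb[OF B p(2) i smooth_kernel_fibre[OF V p(1) x(1) frame_in_fibre[OF B']]])
      finally show ?thesis by (simp add: p(3))
    qed
  qed
  then show ?thesis
    using smooth_kernel_fibre[OF V _ x] unfolding smooth_section_def smooth_fun_def by auto
qed

lemma smooth_kernel_lincomb:
  assumes U: "open U" and V: "\<And>m. m \<in> I \<Longrightarrow> smooth_kernel M E U (V m)"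
  shows "smooth_kernel M E U (\<lambda>y x e. \<Sum>m\<in>I. scl E (a m) (V m y x e))"
  unfolding smooth_kernel_def Let_def
proof (intro conjI ballI allI impI, goal_cases)
  case (1 y x e e' b)
  then show ?case by (intro fibre_lincomb smooth_kernel_fibre[OF V])
next
  case (2 y x e e' b)
  have "V m y x (scl E b e + e') = scl E b (V m y x e) + V m y x e'" if "m \<in> I" for m
    using V[OF that] 2 unfolding smooth_kernel_def by blast
  then show ?case
    by (simp add: scale_right_distrib scale_sum_right sum.distrib mult.commute)
next
  case (3 c c' T)
  obtain B \<Phi> where T: "T = (B, \<Phi>)" by fastforce
  have "smooth_on ((snd c ` (fst c \<inter> B \<inter> U)) \<times> (snd c' ` (fst c' \<inter> B' \<inter> U)))
      (\<lambda>(u, w). \<Phi> (chart_inv c u) (\<Sum>m\<in>I. scl E (a m) (V m (chart_inv c u) (chart_inv c' w)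
         (frame E \<Phi>' j (chart_inv c' w)))) i)" (is "smooth_on ?S _")
    if B': "(B', \<Phi>') \<in> trivs E" and ij: "i < rk E" "j < rk E" for B' \<Phi>' i j
  proof (rule smooth_on_cong)
    have B: "(B, \<Phi>) \<in> trivs E" "(B', \<Phi>') \<in> trivs E" using 3 T B' by auto
    show o: "open ?S"
      using open_chart_image[OF 3(1), of "B \<inter> U"] open_chart_image[OF 3(2), of "B' \<inter> U"]
        triv_open[OF B(1)] triv_open[OF B(2)] U
      by (auto simp: Int_assoc intro!: open_Times)
    show "smooth_on ?S (\<lambda>t. \<Sum>m\<in>I. a m * (case t of (u, w) \<Rightarrow> \<Phi> (chart_inv c u)
       (V m (chart_inv c u) (chart_inv c' w) (frame E \<Phi>' j (chart_inv c' w))) i))"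
      using smooth_kernel_entries[OF V 3(1,2) B ij] by (intro smooth_on_lincomb[OF o])
    show "(\<Sum>m\<in>I. a m * (case t of (u, w) \<Rightarrow> \<Phi> (chart_inv c u)
         (V m (chart_inv c u) (chart_inv c' w) (frame E \<Phi>' j (chart_inv c' w))) i)) =
       (case t of (u, w) \<Rightarrow> \<Phi> (chart_inv c u) (\<Sum>m\<in>I. scl E (a m)
         (V m (chart_inv c u) (chart_inv c' w) (frame E \<Phi>' j (chart_inv c' w)))) i)"
      if "t \<in> ?S" for t
    proof -
      from that obtain y x where t: "t = (snd c y, snd c' x)" and "y \<in> fst c" "y \<in> B" "y \<in> U"
        "x \<in> fst c'" "x \<in> B'" "x \<in> U" by auto
      moreover from this have "\<Phi> y (\<Sum>m\<in>I. scl E (a m) (V m y x (frame E \<Phi>' j x))) i =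
          (\<Sum>m\<in>I. a m * \<Phi> y (V m y x (frame E \<Phi>' j x)) i)"
        by (intro triv_lincomb[OF B(1) _ ij(1)] smooth_kernel_fibre[OF V] frame_in_fibre[OF B(2)])
      ultimately show ?thesis by (simp add: chart_inv_left 3)
    qed
  qed
  then show ?case unfolding T prod.case by blast
qed


section \<open>Linearity of connections and operators on sections\<close>

text \<open>Homogeneity is the Leibniz rule for a constant function, whose differential vanishes.
  The zero section is handled as 0 times itself.\<close>

lemma connection_lincomb:
  assumes D: "is_connection M E D" and W: "open W" "p \<in> W" "v \<in> tangent_space M p"
    and "finite I" "\<And>m. m \<in> I \<Longrightarrow> smooth_section M E W (s m)"
  shows "D (\<lambda>q. \<Sum>m\<in>I. scl E (a m) (s m q)) p v = (\<Sum>m\<in>I. scl E (a m) (D (s m) p v))"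
proof -
  have scale: "D (\<lambda>q. scl E b (t q)) p v = scl E b (D t p v)"
    if "smooth_section M E W t" for t b
  proof -
    have "smooth_fun M W (\<lambda>q. b)"
      by (simp add: smooth_fun_def comp_def smooth_on_const)
    then have "D (\<lambda>q. scl E b (t q)) p v =
        scl E b (D t p v) + scl E (differential M (\<lambda>q. b) p v) (t p)"
      using D W that unfolding is_connection_def by blast
    then show ?thesis by (simp add: differential_def comp_def frechet_derivative_const)
  qed
  have zero: "D (\<lambda>q. 0) p v = 0"
    using scale[of "\<lambda>q. 0" 0] smooth_section_lincomb[OF W(1), of "{}"] by simp
  have add: "D (\<lambda>q. t q + t' q) p v = D t p v + D t' p v"
    if "smooth_section M E W t" "smooth_section M E W t'" for t t'
  proof -
    have "\<forall>s'. smooth_section M E W s' \<longrightarrow> (\<forall>p\<in>W. \<forall>v\<in>tangent_space M p.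
        D (\<lambda>q. t q + s' q) p v = D t p v + D s' p v)"
      using D[unfolded is_connection_def, THEN spec, THEN spec, THEN mp, OF conjI, OF W(1) that(1)]
      by (elim conjE)
    then show ?thesis using W that(2) by blast
  qed
  show ?thesis
    using assms(5,6)
  proof (induction I)
    case (insert m I)
    have "smooth_section M E W (\<lambda>q. scl E (a m) (s m q))"
      using smooth_section_lincomb[OF W(1), of "{m}" s a] insert.prems by simp
    moreover have "smooth_section M E W (\<lambda>q. \<Sum>m\<in>I. scl E (a m) (s m q))"
      by (rule smooth_section_lincomb[OF W(1)]) (use insert.prems in blast)
    ultimately show ?case using insert by (simp add: add scale)
  qed (simp add: zero)
qed

section \<open>Coordinate expressions of normally hyperbolic operators\<close>

lemma pd_cong:
  assumes "c \<in> atlas M" "open W" "p \<in> W" "p \<in> fst c" "\<And>q. q \<in> W \<Longrightarrow> f q = g q"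
    and "smooth_on (snd c ` (fst c \<inter> W)) (f \<circ> chart_inv c)"
  shows "pd c l f p = pd c l g p"
proof -
  have "frechet_derivative (f \<circ> chart_inv c) (at (snd c p)) =
      frechet_derivative (g \<circ> chart_inv c) (at (snd c p))"
  proof (rule frechet_derivative_transform_within_open)
    show "(f \<circ> chart_inv c) differentiable at (snd c p)"
      using smooth_on_differentiable[OF assms(6)] assms(3,4) by blast
    show "open (snd c ` (fst c \<inter> W))" using open_chart_image assms by blast
    show "(f \<circ> chart_inv c) u = (g \<circ> chart_inv c) u" if "u \<in> snd c ` (fst c \<inter> W)" for u
      using that assms(5) chart_inv_left[OF assms(1)] by auto
  qed (use assms in blast)
  then show ?thesis by (simp add: pd_def)
qed

text \<open>Makes first derivatives admissible as arguments of \<open>pd_cong\<close> and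
  \<open>pd_lincomb\<close>, as the second order terms of an operator require.\<close>

lemma smooth_on_pd:
  assumes "c \<in> atlas M" "open W" "smooth_on (snd c ` (fst c \<inter> W)) (f \<circ> chart_inv c)"
  shows "smooth_on (snd c ` (fst c \<inter> W)) (pd c l f \<circ> chart_inv c)"
proof (rule smooth_on_cong[OF _ _ smooth_on_frechet_derivative[OF assms(3)]])
  show "open (snd c ` (fst c \<inter> W))" using open_chart_image assms by blast
  show "frechet_derivative (f \<circ> chart_inv c) (at u) (axis l 1) = (pd c l f \<circ> chart_inv c) u"
    if "u \<in> snd c ` (fst c \<inter> W)" for u
    using that chart_inv_left[OF assms(1)] by (auto simp: pd_def)
qed

lemma pd_lincomb:
  fixes f :: "'i \<Rightarrow> 'm \<Rightarrow> complex"
  assumes "c \<in> atlas M" "p \<in> W" "p \<in> fst c"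
    and "\<And>m. m \<in> I \<Longrightarrow> smooth_on (snd c ` (fst c \<inter> W)) (f m \<circ> chart_inv c)"
  shows "pd c l (\<lambda>q. \<Sum>m\<in>I. a m * f m q) p = (\<Sum>m\<in>I. a m * pd c l (f m) p)"
proof -
  have "(f m \<circ> chart_inv c has_derivative frechet_derivative (f m \<circ> chart_inv c) (at (snd c p)))
      (at (snd c p))" if "m \<in> I" for m
    using smooth_on_differentiable[OF assms(4)[OF that]] assms(2,3)
    by (auto simp: frechet_derivative_works)
  then have "((\<lambda>u. \<Sum>m\<in>I. a m * (f m \<circ> chart_inv c) u) has_derivative
      (\<lambda>v. \<Sum>m\<in>I. a m * frechet_derivative (f m \<circ> chart_inv c) (at (snd c p)) v)) (at (snd c p))"
    by (intro has_derivative_sum has_derivative_mult_right)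
  from frechet_derivative_at[OF this] show ?thesis
    by (auto simp: pd_def comp_def fun_eq_iff)
qed

text \<open>The right-hand side of the coordinate formula in \<open>normally_hyperbolic\<close>,
  named so that linearity in the section and the effect of a shift can be argued with the
  coefficients \<open>a\<close> and \<open>b\<close> held fixed.\<close>

definition local_form ::
  "('m, 'd) chart \<Rightarrow> ('m \<Rightarrow> 'e \<Rightarrow> nat \<Rightarrow> complex) \<Rightarrow> ('d \<Rightarrow> nat \<Rightarrow> nat \<Rightarrow> 'm \<Rightarrow> complex) \<Rightarrow>
     (nat \<Rightarrow> nat \<Rightarrow> 'm \<Rightarrow> complex) \<Rightarrow> ('m \<Rightarrow> 'e) \<Rightarrow> 'm \<Rightarrow> nat \<Rightarrow> complex" where
  "local_form c \<Phi> a b s p i =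
     - (\<Sum>k\<in>UNIV. \<Sum>l\<in>UNIV. of_real (ginv M c p $ k $ l) *
          pd c k (pd c l (\<lambda>q. \<Phi> q (s q) i)) p)
     + (\<Sum>k\<in>UNIV. \<Sum>j<rk E. a k i j p * pd c k (\<lambda>q. \<Phi> q (s q) j) p)
     + (\<Sum>j<rk E. b i j p * \<Phi> p (s p) j)"

definition has_local_form ::
  "('m, 'd) chart \<Rightarrow> 'm set \<Rightarrow> ('m \<Rightarrow> 'e \<Rightarrow> nat \<Rightarrow> complex) \<Rightarrow> (('m \<Rightarrow> 'e) \<Rightarrow> ('m \<Rightarrow> 'e)) \<Rightarrow>
     ('d \<Rightarrow> nat \<Rightarrow> nat \<Rightarrow> 'm \<Rightarrow> complex) \<Rightarrow> (nat \<Rightarrow> nat \<Rightarrow> 'm \<Rightarrow> complex) \<Rightarrow> bool" where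
  "has_local_form c B \<Phi> P a b \<longleftrightarrow>
     (\<forall>i<rk E. \<forall>j<rk E. smooth_fun M (fst c \<inter> B) (b i j) \<and>
        (\<forall>k. smooth_fun M (fst c \<inter> B) (a k i j))) \<and>
     (\<forall>W s. open W \<and> smooth_section M E W s \<longrightarrow> (\<forall>p\<in>W \<inter> fst c \<inter> B.
        P s p \<in> fibre E p \<and> (\<forall>i<rk E. \<Phi> p (P s p) i = local_form c \<Phi> a b s p i)))"

lemma normally_hyperbolic_iff:
  "normally_hyperbolic M E P \<longleftrightarrow>
     (\<forall>c\<in>atlas M. \<forall>(B, \<Phi>)\<in>trivs E. \<exists>a b. has_local_form c B \<Phi> P a b)"
  unfolding normally_hyperbolic_def has_local_form_def local_form_def by (rule refl)

lemma normally_hyperbolicE: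
  assumes "normally_hyperbolic M E P" "c \<in> atlas M" "(B, \<Phi>) \<in> trivs E"
  obtains a b where "has_local_form c B \<Phi> P a b"
  using assms unfolding normally_hyperbolic_iff by blast

lemma local_form_lincomb:
  assumes c: "c \<in> atlas M" "p \<in> fst c" and B: "(B, \<Phi>) \<in> trivs E" "p \<in> B"
    and W: "open W" "p \<in> W" and i: "i < rk E"
    and s: "\<And>m. m \<in> I \<Longrightarrow> smooth_section M E W (s m)"
  shows "local_form c \<Phi> a b (\<lambda>q. \<Sum>m\<in>I. scl E (w m) (s m q)) p i =
    (\<Sum>m\<in>I. w m * local_form c \<Phi> a b (s m) p i)"
proof -
  define S where "S = W \<inter> B"
  have sum_smooth: "smooth_section M E W (\<lambda>q. \<Sum>m\<in>I. scl E (w m) (s m q))"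
    by (rule smooth_section_lincomb[OF W(1) s])
  have fib: "s m q \<in> fibre E q" if "m \<in> I" "q \<in> W" for m q
    using s that unfolding smooth_section_def by blast
  have S: "open S" "p \<in> S" using W B triv_open[OF B(1)] by (auto simp: S_def)
  have chart: "smooth_on (snd c ` (fst c \<inter> S)) ((\<lambda>q. \<Phi> q (t q) i) \<circ> chart_inv c)"
    if "smooth_section M E W t" "i < rk E" for t i
    unfolding S_def by (rule smooth_section_coordinate[OF that(1) B(1) that(2) c(1)])
  have triv_sum: "\<Phi> q (\<Sum>m\<in>I. scl E (w m) (s m q)) i = (\<Sum>m\<in>I. w m * \<Phi> q (s m q) i)"
    if "q \<in> S" "i < rk E" for q i
    using that fib by (intro triv_lincomb[OF B(1)]) (auto simp: S_def)
  have pd1: "pd c l (\<lambda>q. \<Phi> q (\<Sum>m\<in>I. scl E (w m) (s m q)) i) q =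
      (\<Sum>m\<in>I. w m * pd c l (\<lambda>q. \<Phi> q (s m q) i) q)"
    if q: "q \<in> S" "q \<in> fst c" and i: "i < rk E" for q i l
  proof -
    have "pd c l (\<lambda>q. \<Phi> q (\<Sum>m\<in>I. scl E (w m) (s m q)) i) q =
        pd c l (\<lambda>q. \<Sum>m\<in>I. w m * \<Phi> q (s m q) i) q"
      by (rule pd_cong[OF c(1) S(1) q triv_sum[OF _ i] chart[OF sum_smooth i]])
    also have "\<dots> = (\<Sum>m\<in>I. w m * pd c l (\<lambda>q. \<Phi> q (s m q) i) q)"
      by (rule pd_lincomb[OF c(1) q chart[OF s i]])
    finally show ?thesis .
  qed
  have pd2: "pd c k (pd c l (\<lambda>q. \<Phi> q (\<Sum>m\<in>I. scl E (w m) (s m q)) i)) p =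
      (\<Sum>m\<in>I. w m * pd c k (pd c l (\<lambda>q. \<Phi> q (s m q) i)) p)" for k l
  proof -
    \<comment> \<open>A second derivative at \<open>p\<close> needs the first order identity
      \<open>pd1\<close> on a whole neighbourhood of \<open>p\<close>. It holds where both the
      trivialization and the chart are defined, so \<open>S\<close> is cut down to the chart
      domain.\<close>
    let ?S = "S \<inter> fst c"
    have eq: "fst c \<inter> ?S = fst c \<inter> S" by blast
    have o: "open ?S" "p \<in> ?S" using S c atlas_M by (auto simp: smooth_atlas_def)
    have "pd c k (pd c l (\<lambda>q. \<Phi> q (\<Sum>m\<in>I. scl E (w m) (s m q)) i)) p =
        pd c k (\<lambda>q. \<Sum>m\<in>I. w m * pd c l (\<lambda>q. \<Phi> q (s m q) i) q) p"
    proof (rule pd_cong[OF c(1) o c(2)])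
      show "smooth_on (snd c ` (fst c \<inter> ?S))
          (pd c l (\<lambda>q. \<Phi> q (\<Sum>m\<in>I. scl E (w m) (s m q)) i) \<circ> chart_inv c)"
        unfolding eq by (rule smooth_on_pd[OF c(1) S(1) chart[OF sum_smooth i]])
    qed (rule pd1[OF _ _ i], blast+)
    also have "\<dots> = (\<Sum>m\<in>I. w m * pd c k (pd c l (\<lambda>q. \<Phi> q (s m q) i)) p)"
      by (rule pd_lincomb[OF c(1) S(2) c(2) smooth_on_pd[OF c(1) S(1) chart[OF s i]]])
    finally show ?thesis .
  qed
  have swap: "(\<Sum>k\<in>A. \<Sum>l\<in>B. \<Sum>m\<in>I. f k l m) = (\<Sum>m\<in>I. \<Sum>k\<in>A. \<Sum>l\<in>B. f k l m)"
    for A :: "'d set" and B :: "'t set" and f :: "'d \<Rightarrow> 't \<Rightarrow> _ \<Rightarrow> complex"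
    by (simp only: sum.swap[of _ I])
  have 1: "(\<Sum>k\<in>UNIV. \<Sum>l\<in>UNIV. of_real (ginv M c p $ k $ l) *
        pd c k (pd c l (\<lambda>q. \<Phi> q (\<Sum>m\<in>I. scl E (w m) (s m q)) i)) p) =
      (\<Sum>m\<in>I. w m * (\<Sum>k\<in>UNIV. \<Sum>l\<in>UNIV. of_real (ginv M c p $ k $ l) *
        pd c k (pd c l (\<lambda>q. \<Phi> q (s m q) i)) p))"
    unfolding pd2 sum_distrib_left swap by (simp add: mult.left_commute)
  have "(\<Sum>k\<in>UNIV. \<Sum>j<rk E. a k i j p *
        pd c k (\<lambda>q. \<Phi> q (\<Sum>m\<in>I. scl E (w m) (s m q)) j) p) =
      (\<Sum>k\<in>UNIV. \<Sum>j<rk E. a k i j p * (\<Sum>m\<in>I. w m * pd c k (\<lambda>q. \<Phi> q (s m q) j) p))"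
    by (intro sum.cong refl) (simp add: pd1[OF S(2) c(2)])
  also have "\<dots> = (\<Sum>m\<in>I. w m * (\<Sum>k\<in>UNIV. \<Sum>j<rk E. a k i j p * pd c k (\<lambda>q. \<Phi> q (s m q) j) p))"
    unfolding sum_distrib_left swap by (simp add: mult.left_commute)
  finally have 2: "(\<Sum>k\<in>UNIV. \<Sum>j<rk E. a k i j p *
        pd c k (\<lambda>q. \<Phi> q (\<Sum>m\<in>I. scl E (w m) (s m q)) j) p) = \<dots>" .
  have "(\<Sum>j<rk E. b i j p * \<Phi> p (\<Sum>m\<in>I. scl E (w m) (s m p)) j) =
      (\<Sum>j<rk E. b i j p * (\<Sum>m\<in>I. w m * \<Phi> p (s m p) j))"
    by (intro sum.cong refl) (simp add: triv_sum[OF S(2)])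
  also have "\<dots> = (\<Sum>m\<in>I. w m * (\<Sum>j<rk E. b i j p * \<Phi> p (s m p) j))"
    unfolding sum_distrib_left by (subst sum.swap) (simp add: mult.left_commute)
  finally have 3: "(\<Sum>j<rk E. b i j p * \<Phi> p (\<Sum>m\<in>I. scl E (w m) (s m p)) j) = \<dots>" .
  show ?thesis
    unfolding local_form_def 1 2 3
    by (simp add: distrib_left right_diff_distrib sum.distrib sum_subtractf)
qed

text \<open>\<open>P\<close> is a priori any map on total functions. One choice of coefficients
  serves all smooth sections near \<open>p\<close>, so linearity can be read off coordinate by
  coordinate.\<close>

lemma normally_hyperbolic_lincomb:
  assumes P: "normally_hyperbolic M E P" and W: "open W" "p \<in> W"
    and s: "\<And>m. m \<in> I \<Longrightarrow> smooth_section M E W (s m)"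
  shows "P (\<lambda>q. \<Sum>m\<in>I. scl E (w m) (s m q)) p = (\<Sum>m\<in>I. scl E (w m) (P (s m) p))"
proof -
  obtain c where c: "c \<in> atlas M" "p \<in> fst c" by (rule chart_around)
  obtain B \<Phi> where B: "(B, \<Phi>) \<in> trivs E" "p \<in> B" by (rule triv_around)
  obtain a b where ab: "has_local_form c B \<Phi> P a b"
    by (rule normally_hyperbolicE[OF P c(1) B(1)])
  have fib: "P t p \<in> fibre E p" and form: "i < rk E \<Longrightarrow> \<Phi> p (P t p) i = local_form c \<Phi> a b t p i"
    if "smooth_section M E W t" for t i
    using ab that W c(2) B(2) unfolding has_local_form_def by blast+
  have sum_smooth: "smooth_section M E W (\<lambda>q. \<Sum>m\<in>I. scl E (w m) (s m q))"
    by (rule smooth_section_lincomb[OF W(1) s])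
  show ?thesis
  proof (rule triv_eqI[OF B])
    show "P (\<lambda>q. \<Sum>m\<in>I. scl E (w m) (s m q)) p \<in> fibre E p"
      by (rule fib[OF sum_smooth])
    show "(\<Sum>m\<in>I. scl E (w m) (P (s m) p)) \<in> fibre E p"
      by (rule fibre_lincomb[OF fib[OF s]])
    fix i assume i: "i < rk E"
    have "\<Phi> p (P (\<lambda>q. \<Sum>m\<in>I. scl E (w m) (s m q)) p) i =
        (\<Sum>m\<in>I. w m * local_form c \<Phi> a b (s m) p i)"
      unfolding form[OF sum_smooth i] by (rule local_form_lincomb[OF c B W i s])
    also have "\<dots> = (\<Sum>m\<in>I. w m * \<Phi> p (P (s m) p) i)"
      by (intro sum.cong refl) (simp add: form[OF s i])
    also have "\<dots> = \<Phi> p (\<Sum>m\<in>I. scl E (w m) (P (s m) p)) i"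
      by (rule triv_lincomb[OF B i fib[OF s], symmetric])
    finally show "\<Phi> p (P (\<lambda>q. \<Sum>m\<in>I. scl E (w m) (s m q)) p) i =
        \<Phi> p (\<Sum>m\<in>I. scl E (w m) (P (s m) p)) i" .
  qed
qed

text \<open>Only the zeroth order matrix changes, by \<open>- z\<close> times the identity. The
  result lets \<open>P - z\<close> play the role of \<open>P\<close>, so that a shift by
  \<open>- z\<close> can undo the shift by \<open>z\<close>.\<close>

lemma normally_hyperbolic_shift:
  assumes P: "normally_hyperbolic M E P"
  shows "normally_hyperbolic M E (\<lambda>s p. P s p - scl E z (s p))"
proof -
  have "\<exists>a b. has_local_form c B \<Phi> (\<lambda>s p. P s p - scl E z (s p)) a b"
    if c: "c \<in> atlas M" and B: "(B, \<Phi>) \<in> trivs E" for c B \<Phi>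
  proof -
    obtain a b where ab: "has_local_form c B \<Phi> P a b"
      by (rule normally_hyperbolicE[OF P c B])
    let ?b = "\<lambda>i j p. b i j p + (if i = j then - z else 0)"
    have a: "smooth_fun M (fst c \<inter> B) (a k i j)" and b: "smooth_fun M (fst c \<inter> B) (b i j)"
      if "i < rk E" "j < rk E" for i j k
      using ab that unfolding has_local_form_def by blast+
    have b': "smooth_fun M (fst c \<inter> B) (?b i j)" if "i < rk E" "j < rk E" for i j
      unfolding smooth_fun_def
    proof
      fix c' assume c': "c' \<in> atlas M"
      have "open (fst c)" using atlas_M c by (auto simp: smooth_atlas_def)
      then have "open (snd c' ` (fst c' \<inter> (fst c \<inter> B)))"
        by (intro open_chart_image[OF c'] open_Int triv_open[OF B])
      moreover have "smooth_on (snd c' ` (fst c' \<inter> (fst c \<inter> B))) (b i j \<circ> chart_inv c')"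
        using b[OF that] c' unfolding smooth_fun_def by blast
      ultimately show "smooth_on (snd c' ` (fst c' \<inter> (fst c \<inter> B))) (?b i j \<circ> chart_inv c')"
        using smooth_on_add[OF _ _ smooth_on_const[of _ "if i = j then - z else 0"]]
        unfolding comp_def by blast
    qed
    have form': "P s p - scl E z (s p) \<in> fibre E p \<and>
        (\<forall>i<rk E. \<Phi> p (P s p - scl E z (s p)) i = local_form c \<Phi> a ?b s p i)"
      if W: "open W" and s: "smooth_section M E W s" and p: "p \<in> W \<inter> fst c \<inter> B" for W s p
    proof (intro conjI allI impI)
      have Pp: "P s p \<in> fibre E p"
        and form: "i < rk E \<Longrightarrow> \<Phi> p (P s p) i = local_form c \<Phi> a b s p i" for i
        using ab W s p unfolding has_local_form_def by blast+
      have sp: "s p \<in> fibre E p" using s p unfolding smooth_section_def by blast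
      show "P s p - scl E z (s p) \<in> fibre E p"
        by (intro subspace_diff subspace_scale fibre_subspace Pp sp)
      fix i assume i: "i < rk E"
      have "\<Phi> p (P s p - scl E z (s p)) i = \<Phi> p (P s p) i - z * \<Phi> p (s p) i"
        using triv_linear[OF B _ sp Pp i, of "- z"] p by simp
      moreover have "(\<Sum>j<rk E. ?b i j p * \<Phi> p (s p) j) =
          (\<Sum>j<rk E. b i j p * \<Phi> p (s p) j) - z * \<Phi> p (s p) i"
      proof -
        have "(\<Sum>j<rk E. (if i = j then - z else 0) * \<Phi> p (s p) j) =
            (\<Sum>j<rk E. if i = j then - z * \<Phi> p (s p) j else 0)"
          by (intro sum.cong) auto
        then show ?thesis using i by (simp add: distrib_right sum.distrib)
      qed
      ultimately show "\<Phi> p (P s p - scl E z (s p)) i = local_form c \<Phi> a ?b s p i"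
        using form[OF i] by (simp add: local_form_def)
    qed
    have "has_local_form c B \<Phi> (\<lambda>s p. P s p - scl E z (s p)) a ?b"
      unfolding has_local_form_def
    proof (rule conjI)
      show "\<forall>i<rk E. \<forall>j<rk E. smooth_fun M (fst c \<inter> B) (?b i j) \<and>
          (\<forall>k. smooth_fun M (fst c \<inter> B) (a k i j))"
        by (intro allI impI conjI a b')
    qed (intro allI impI ballI form'; elim conjE)
    then show ?thesis by blast
  qed
  then show ?thesis unfolding normally_hyperbolic_iff by blast
qed

text \<open>The scalars \<open>z\<close> and \<open>f p\<close> commute, so the shift adds the same
  term to both sides of the product identity that characterizes the connection.\<close>

lemma induced_connection_shift:
  assumes "induced_connection M E P D"
  shows "induced_connection M E (\<lambda>s p. P s p - scl E z (s p)) D"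
  unfolding induced_connection_def
proof (intro conjI allI impI ballI)
  show "is_connection M E D" using assms by (simp add: induced_connection_def)
  fix W s and f :: "'m \<Rightarrow> real" and p
  assume "open W \<and> smooth_section M E W s \<and> smooth_fun M W f" "p \<in> W"
  then have "P (\<lambda>q. scl E (of_real (f q)) (s q)) p =
      scl E (of_real (f p)) (P s p) - scl E 2 (D s p (gradient M f p))
      + scl E (of_real (box M f p)) (s p)"
    using assms unfolding induced_connection_def by blast
  then show "P (\<lambda>q. scl E (of_real (f q)) (s q)) p - scl E z (scl E (of_real (f p)) (s p)) =
      scl E (of_real (f p)) (P s p - scl E z (s p)) - scl E 2 (D s p (gradient M f p))
      + scl E (of_real (box M f p)) (s p)"
    by (simp add: scale_right_diff_distrib mult.commute)
qed


section \<open>The binomial transform of Hadamard families\<close>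

definition binomial_transform ::
  "(complex \<Rightarrow> 'e \<Rightarrow> 'e) \<Rightarrow> complex \<Rightarrow> (nat \<Rightarrow> 'm \<Rightarrow> 'm \<Rightarrow> 'e \<Rightarrow> 'e) \<Rightarrow> nat \<Rightarrow> 'm \<Rightarrow> 'm \<Rightarrow> 'e \<Rightarrow> 'e::ab_group_add"
where
  "binomial_transform scal z V k y x e =
     (\<Sum>m=0..k. scal (of_nat (k choose m) * z ^ m) (V (k - m) y x e))"

text \<open>The transform is unitriangular.\<close>

lemma inj_binomial_transform: "inj (binomial_transform (scl E) z)"
proof (rule injI)
  fix V V' assume eq: "binomial_transform (scl E) z V = binomial_transform (scl E) z V'"
  have "V k y x e = V' k y x e" for k y x e
  proof (induction k rule: less_induct)
    case (less k)
    have split: "binomial_transform (scl E) z V k y x e = V k y x e +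
        (\<Sum>m=Suc 0..k. scl E (of_nat (k choose m) * z ^ m) (V (k - m) y x e))" for V
      by (simp add: binomial_transform_def sum.atLeast_Suc_atMost[of 0 k])
    have "(\<Sum>m=Suc 0..k. scl E (of_nat (k choose m) * z ^ m) (V (k - m) y x e)) =
        (\<Sum>m=Suc 0..k. scl E (of_nat (k choose m) * z ^ m) (V' (k - m) y x e))"
      using less by (intro sum.cong) auto
    then show ?case using split[of V] split[of V'] eq by simp
  qed
  then show "V = V'" by (simp add: fun_eq_iff)
qed

text \<open>With \<open>F j\<close>, \<open>R j\<close> and \<open>G j\<close> standing for \<open>V\<^sup>j\<close>, \<open>\<rho> V\<^sup>j\<close> and \<open>P V\<^sup>j\<close>, this is the transport
  equation for the transform. It rests on the absorption identities
  \<open>(k - m) (k choose m) = k (k - 1 choose m)\<close> and \<open>m (k choose m) = k (k - 1 choose m - 1)\<close>.\<close>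

lemma binomial_transform_transport:
  fixes R F G :: "nat \<Rightarrow> 'e" and z :: complex
  assumes "\<And>k. R k - scl E (of_nat (2 * k)) (F k) =
    (if k = 0 then 0 else scl E (of_nat (2 * k)) (G (k - 1)))"
  defines "T \<equiv> \<lambda>X k. \<Sum>m=0..k. scl E (of_nat (k choose m) * z ^ m) (X (k - m))"
  shows "T R k - scl E (of_nat (2 * k)) (T F k) =
    (if k = 0 then 0 else scl E (of_nat (2 * k)) (T G (k - 1) - scl E z (T F (k - 1))))"
proof (cases k)
  case 0
  then show ?thesis using assms(1)[of 0] by (simp add: T_def)
next
  case (Suc n)
  let ?a = "\<lambda>m. of_nat (k choose m) * z ^ m"
  let ?b = "\<lambda>m. of_nat (n choose m) * z ^ m"
  have R: "R j = scl E (of_nat (2 * j)) (F j) +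
      (if j = 0 then 0 else scl E (of_nat (2 * j)) (G (j - 1)))" for j
    using assms(1)[of j] by (simp add: algebra_simps)
  \<comment> \<open>Inserting \<open>R\<close> gives \<open>F (k - m)\<close> the factor 2(k - m) -
    2k = -2m. The \<open>G\<close> term is absent for \<open>m = k\<close>, since \<open>R 0\<close>
    involves no \<open>G\<close>.\<close>
  have summand: "scl E (?a m) (R (k - m)) - scl E (of_nat (2 * k)) (scl E (?a m) (F (k - m))) =
      (if m = k then 0 else scl E (?a m * of_nat (2 * (k - m))) (G (n - m)))
      - scl E (?a m * of_nat (2 * m)) (F (k - m))"
    if "m \<le> k" for m
  proof -
    have "scl E (?a m * of_nat (2 * (k - m))) (F (k - m))
        - scl E (of_nat (2 * k) * ?a m) (F (k - m)) = - scl E (?a m * of_nat (2 * m)) (F (k - m))"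
      using that unfolding scale_left_diff_distrib[symmetric] scale_minus_left[symmetric]
      by (intro arg_cong2[where f = "scl E"]) (simp_all add: of_nat_diff algebra_simps)
    moreover have "k - m - 1 = n - m" using Suc by simp
    ultimately show ?thesis
      using that by (subst R) (auto simp: scale_right_distrib algebra_simps)
  qed
  have "T R k - scl E (of_nat (2 * k)) (T F k) =
      (\<Sum>m=0..k. scl E (?a m) (R (k - m)) - scl E (of_nat (2 * k)) (scl E (?a m) (F (k - m))))"
    by (simp only: T_def scale_sum_right sum_subtractf)
  also have "\<dots> = (\<Sum>m=0..k. (if m = k then 0 else scl E (?a m * of_nat (2 * (k - m))) (G (n - m)))
      - scl E (?a m * of_nat (2 * m)) (F (k - m)))"
    using summand by (intro sum.cong) auto
  also have "\<dots> = (\<Sum>m=0..k. if m = k then 0 else scl E (?a m * of_nat (2 * (k - m))) (G (n - m)))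
      - (\<Sum>m=0..k. scl E (?a m * of_nat (2 * m)) (F (k - m)))"
    by (rule sum_subtractf)
  \<comment> \<open>Dropping the vanishing summand \<open>m = k\<close> leaves the range of a
    transform of order \<open>n\<close>, with n = k - 1.\<close>
  also have "(\<Sum>m=0..k. if m = k then 0 else scl E (?a m * of_nat (2 * (k - m))) (G (n - m))) =
      (\<Sum>m=0..n. scl E (?a m * of_nat (2 * (k - m))) (G (n - m)))"
    unfolding Suc sum.atLeast0_atMost_Suc by (auto intro!: sum.cong)
  also have "\<dots> = (\<Sum>m=0..n. scl E (of_nat (2 * k) * ?b m) (G (n - m)))"
  proof (intro sum.cong refl arg_cong2[where f = "scl E"])
    fix m assume "m \<in> {0..n}"
    have eq: "(k choose m) * (2 * (k - m)) = 2 * k * (n choose m)"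
      using binomial_absorb_comp[of k m] Suc by (simp only: diff_Suc_1 mult_ac)
    have "?a m * of_nat (2 * (k - m)) = of_nat ((k choose m) * (2 * (k - m))) * z ^ m"
      by (simp only: of_nat_mult mult_ac)
    then show "?a m * of_nat (2 * (k - m)) = of_nat (2 * k) * ?b m"
      unfolding eq by (simp only: of_nat_mult mult_ac)
  qed
  \<comment> \<open>Here it is the summand \<open>m = 0\<close> that vanishes; shifting the index by
    one again leaves order \<open>n\<close>, and the extra power of \<open>z\<close> becomes the
    factor of the zeroth order term of P - z.\<close>
  also have "(\<Sum>m=0..k. scl E (?a m * of_nat (2 * m)) (F (k - m))) =
      (\<Sum>m=0..n. scl E (?a (Suc m) * of_nat (2 * Suc m)) (F (n - m)))"
    unfolding Suc sum.atLeast0_atMost_Suc_shift by simp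
  also have "\<dots> = (\<Sum>m=0..n. scl E (of_nat (2 * k) * (z * ?b m)) (F (n - m)))"
  proof (intro sum.cong refl arg_cong2[where f = "scl E"])
    fix m
    have eq: "(k choose Suc m) * (2 * Suc m) = 2 * k * (n choose m)"
      using Suc_times_binomial[of m n] Suc by (simp only: mult_ac)
    have "?a (Suc m) * of_nat (2 * Suc m) = of_nat ((k choose Suc m) * (2 * Suc m)) * (z * z ^ m)"
      by (simp only: of_nat_mult power_Suc mult_ac)
    then show "?a (Suc m) * of_nat (2 * Suc m) = of_nat (2 * k) * (z * ?b m)"
      unfolding eq by (simp only: of_nat_mult mult_ac)
  qed
  finally show ?thesis
    using Suc by (simp add: T_def scale_sum_right scale_right_diff_distrib del: of_nat_Suc)
qed

lemma hadamard_family_shift: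
  assumes P: "normally_hyperbolic M E P" and U: "GE_set M U" and V: "hadamard_family M E P U V"
  shows "hadamard_family M E (\<lambda>s p. P s p - scl E z (s p)) U (binomial_transform (scl E) z V)"
proof -
  let ?a = "\<lambda>k m. of_nat (k choose m) * z ^ m"
  let ?W = "binomial_transform (scl E) z V"
  note fam = V[unfolded hadamard_family_def]
  have ker: "smooth_kernel M E U (V k)" for k
    using fam[THEN conjunct1] by blast
  obtain D where D: "induced_connection M E P D" and transport:
    "\<forall>k. \<forall>y\<in>U. \<forall>x\<in>U. \<forall>e\<in>fibre E x.
      rho M E D U (V k) y x e - scl E (of_nat (2 * k)) (V k y x e) =
      (if k = 0 then 0 else scl E (of_nat (2 * k)) (P (\<lambda>q. V (k - 1) q x e) y))"
    using fam[THEN conjunct2, THEN conjunct1] by (elim exE conjE)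
  have conn: "is_connection M E D" using D by (simp add: induced_connection_def)
  have V0: "V 0 x x e = e" if "x \<in> U" "e \<in> fibre E x" for x e
    using fam[THEN conjunct2, THEN conjunct2, THEN conjunct1] that by blast
  have out: "V k y x e = 0" if "\<not> (y \<in> U \<and> x \<in> U \<and> e \<in> fibre E x)" for k y x e
    using fam[THEN conjunct2, THEN conjunct2, THEN conjunct2] that by blast
  have openU: "open U" using U by (simp add: GE_set_def)
  have "rho M E D U (?W k) y x e - scl E (of_nat (2 * k)) (?W k y x e) =
      (if k = 0 then 0 else scl E (of_nat (2 * k))
        (P (\<lambda>q. ?W (k - 1) q x e) y - scl E z (?W (k - 1) y x e)))"
    if yx: "y \<in> U" "x \<in> U" "e \<in> fibre E x" for k y x e
  proof -
    have sec: "smooth_section M E U (\<lambda>q. V k q x e)" for k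
      using smooth_kernel_section[OF ker openU yx(2,3)] .
    have DW: "D (\<lambda>q. ?W k q x e) y v = (\<Sum>m=0..k. scl E (?a k m) (D (\<lambda>q. V (k - m) q x e) y v))"
      if "v \<in> tangent_space M y" for v
      unfolding binomial_transform_def
      by (rule connection_lincomb[OF conn openU yx(1) that _ sec]) simp
    have PW: "P (\<lambda>q. ?W k q x e) y = (\<Sum>m=0..k. scl E (?a k m) (P (\<lambda>q. V (k - m) q x e) y))" for k
      unfolding binomial_transform_def
      by (rule normally_hyperbolic_lincomb[OF P openU yx(1) sec])
    \<comment> \<open>The derivative in \<open>rho\<close> is taken along grad Gamma, to which
      \<open>DW\<close> applies because it is tangent; the remaining term is multiplication by a
      scalar. So \<open>rho\<close> passes through the sum.\<close>
    have "rho M E D U (?W k) y x e = (\<Sum>m=0..k. scl E (?a k m) (rho M E D U (V (k - m)) y x e))"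
      unfolding rho_def DW[OF gradient_Gam_tangent[OF U yx(2,1)]]
      by (simp add: binomial_transform_def scale_sum_right scale_right_diff_distrib sum_subtractf
          mult.commute)
    then show ?thesis
      using binomial_transform_transport[of "\<lambda>k. rho M E D U (V k) y x e" "\<lambda>k. V k y x e"
          "\<lambda>k. P (\<lambda>q. V k q x e) y" k z, OF transport[rule_format, OF yx]]
      unfolding PW by (simp only: binomial_transform_def)
  qed
  then have "\<exists>D. induced_connection M E (\<lambda>s p. P s p - scl E z (s p)) D \<and>
      (\<forall>k. \<forall>y\<in>U. \<forall>x\<in>U. \<forall>e\<in>fibre E x.
        rho M E D U (?W k) y x e - scl E (of_nat (2 * k)) (?W k y x e) =
        (if k = 0 then 0 else scl E (of_nat (2 * k))
          (P (\<lambda>q. ?W (k - 1) q x e) y - scl E z (?W (k - 1) y x e))))"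
    by (intro exI[of _ D] conjI induced_connection_shift[OF D]) blast
  moreover have "smooth_kernel M E U (?W k)" for k
    unfolding binomial_transform_def[abs_def] by (rule smooth_kernel_lincomb[OF openU ker])
  moreover have "?W 0 x x e = e" if "x \<in> U" "e \<in> fibre E x" for x e
    using V0[OF that] by (simp add: binomial_transform_def)
  moreover have "?W k y x e = 0" if "\<not> (y \<in> U \<and> x \<in> U \<and> e \<in> fibre E x)" for k y x e
    using out[OF that] by (simp add: binomial_transform_def)
  ultimately show ?thesis
    unfolding hadamard_family_def by (intro conjI allI ballI impI)
qed

lemma ex1_hadamard_family_shift:
  assumes P: "normally_hyperbolic M E P" and U: "GE_set M U"
    and ex1: "\<exists>!V. hadamard_family M E P U V"
  shows "\<exists>!V. hadamard_family M E (\<lambda>s p. P s p - scl E z (s p)) U V"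
proof -
  let ?Pz = "\<lambda>s p. P s p - scl E z (s p)"
  \<comment> \<open>Shifting by \<open>z\<close> and then by \<open>- z\<close> returns
    \<open>P\<close> itself as a function, so the result is a family for \<open>P\<close> and not
    merely for an operator that agrees with it on smooth sections.\<close>
  have unshift: "hadamard_family M E P U (binomial_transform (scl E) (- z) V)"
    if "hadamard_family M E ?Pz U V" for V
    using hadamard_family_shift[OF normally_hyperbolic_shift[OF P] U that, of "- z"] by simp
  obtain V where "hadamard_family M E P U V" using ex1 by blast
  then have "hadamard_family M E ?Pz U (binomial_transform (scl E) z V)"
    by (rule hadamard_family_shift[OF P U])
  moreover have "V = V'" if "hadamard_family M E ?Pz U V" "hadamard_family M E ?Pz U V'" for V V'
    using injD[OF inj_binomial_transform] unshift[OF that(1)] unshift[OF that(2)] ex1 by blast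
  ultimately show ?thesis by blast
qed

lemma hadamard_coeff_shift:
  assumes P: "normally_hyperbolic M E P" and U: "GE_set M U"
  shows "hadamard_coeff M E (\<lambda>s p. P s p - scl E z (s p)) U =
    binomial_transform (scl E) z (hadamard_coeff M E P U)"
proof (cases "\<exists>!V. hadamard_family M E P U V")
  case True
  let ?Pz = "\<lambda>s p. P s p - scl E z (s p)"
  have ex1: "\<exists>!V. hadamard_family M E ?Pz U V"
    by (rule ex1_hadamard_family_shift[OF P U True])
  have "hadamard_family M E P U (hadamard_coeff M E P U)"
    using theI'[OF True] True by (simp add: hadamard_coeff_def)
  then have "hadamard_family M E ?Pz U (binomial_transform (scl E) z (hadamard_coeff M E P U))"
    by (rule hadamard_family_shift[OF P U])
  then show ?thesis
    using ex1 the1_equality[OF ex1] by (simp add: hadamard_coeff_def[of M E ?Pz])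
next
  \<comment> \<open>Unique existence for P - z would carry over to \<open>P\<close> by the shift
    with \<open>- z\<close>. Hence both coefficient families take the default value 0, and the
    transform of 0 is 0.\<close>
  case False
  then have "\<not> (\<exists>!V. hadamard_family M E (\<lambda>s p. P s p - scl E z (s p)) U V)"
    using ex1_hadamard_family_shift[OF normally_hyperbolic_shift[OF P] U, of z "- z"] by auto
  with False show ?thesis
    by (simp add: hadamard_coeff_def binomial_transform_def fun_eq_iff)
qed

end

theorem proposition4p2:
  fixes M :: "('m::{t2_space, second_countable_topology}, 'd::finite) spacetime"
    and E :: "('m, 'e::ab_group_add) cbundle"
    and P :: "('m \<Rightarrow> 'e) \<Rightarrow> ('m \<Rightarrow> 'e)"
    and U :: "'m set" and z :: complex and k :: nat
  assumes "lorentzian_manifold M" and "globally_hyperbolic M UNIV"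
    and "complex_vector_bundle M E" and "normally_hyperbolic M E P"
    and "GE_set M U"
    and "y \<in> U" and "x \<in> U" and "e \<in> fibre E x"
  shows "hadamard_coeff M E (\<lambda>s p. P s p - scl E z (s p)) U k y x e =
    (\<Sum>m=0..k. scl E (of_nat (k choose m) * z ^ m) (hadamard_coeff M E P U (k - m) y x e))"
proof -
  interpret bundle_over_manifold M E
    using assms by unfold_locales (auto simp: lorentzian_manifold_def)
  show ?thesis
    using hadamard_coeff_shift[OF assms(4,5)] by (simp add: binomial_transform_def)
qed

end
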